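(* Let $L,N$ be integers with $1\le N\le L-1$. Let $A$ be the adjacency matrix of the configuration graph $\mathcal C_{L,N}$, $\rho$ its spectral radius and $\psi$ its positive (Perron--Frobenius) eigenfunction. With $\psi_\xi$, $\rho_\xi$ and the compact configuration $c\in\mathcal C_{L,N}$ as defined in the context: (i) $\psi$ is equal to $\psi_c$ (up to a constant of unit modulus), with eigenvalue $\rho=\rho_c$. More precisely, for $\eta=(\eta_1<\cdots<\eta_N)\in\mathcal C_{L,N}$, $$\psi(\eta)=\frac{2^{N(N-1)/2}}{L^{N/2}}\prod_{1\le i<j\le N}\sin\left(\frac{(\eta_j-\eta_i)\pi}L\right)\qquad\text{and}\qquad \rho=\frac{2\sin\left(\frac{N\pi}L\right)}{\sin\left(\frac\pi L\right)}.$$ (ii) The map $\xi\mapsto(\eta\in\mathcal C_{L,N}\mapsto\psi_\xi(\eta))$ is a bijection from $\mathcal C_{L,N}$ onto an orthonormal basis of $\ell^2(\mathcal C_{L,N})$ consisting of eigenfunctions of $A$, and for every $\xi\in\mathcal C_{L,N}$ the eigenvalue associated with $\psi_\xi$ is $\rho_\xi$. In particular, the spectrum of $A$ is $\{\rho_\xi:\xi\in\mathcal C_{L,N}\}$.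
   Context: $\mathcal C_{L,N}$ is the set of subsets of $\{0,\dots,L-1\}\simeq\mathbb Z/L\mathbb Z$ of cardinality $N$, identified with increasing tuples $0\le\xi_1<\cdots<\xi_N\le L-1$. It is an undirected connected graph: two configurations are joined when one is obtained from the other by moving exactly one particle to a nearest-neighbour ($\pm1$ mod $L$) empty site. $\ell^2(\mathcal C_{L,N})$ carries the usual Hermitian scalar product. The positive eigenfunction $\psi$ of $A$ associated with $\rho$ is a priori defined up to a positive multiplicative constant; here it is normalized in $\ell^2(\mathcal C_{L,N})$. Set $\gamma=0$ if $N$ is odd and $\gamma=\frac12$ if $N$ is even. For $\xi\in\mathcal C_{L,N}$ and $\eta\in\mathbb R^N$, $$\psi_\xi(\eta)=\frac1{L^{N/2}}\det\left(e^{\frac{2i\pi(\xi_k+\gamma)\eta_j}L}\right)_{1\le k,j\le N},\qquad \rho_\xi=2\sum_{i=1}^N\cos\left(\frac{2\pi(\xi_i+\gamma)}L\right).$$ The compact configuration is $c=(0,1,\dots,p,L-p,\dots,L-1)$ if $N=2p+1$ and $c=(0,1,\dots,p-1,L-p,\dots,L-1)$ if $N=2p$.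
   Formalization: For L = 2, N = 1 the edge between the two configurations is counted twice in A (the moves +1 and -1 coincide mod 2); with a simple edge the spectral radius would be 1, while the stated formula gives 2. For L ≥ 3, A is the usual 0/1 adjacency matrix. *)

theory Defs
  imports
    "Jordan_Normal_Form.Spectral_Radius"
    "Jordan_Normal_Form.VS_Connect"
    "Jordan_Normal_Form.Determinant"
begin

section \<open>The configuration graph\<close>

definition configs :: "nat \<Rightarrow> nat \<Rightarrow> nat set set" where
  "configs L N = {\<eta>. \<eta> \<subseteq> {..<L} \<and> card \<eta> = N}"

text \<open>The increasing tuple identified with a configuration; positions are counted from 0, so
  \<open>site \<eta> k\<close> is the entry with index \<open>k + 1\<close> in the usual notation.\<close>

definition site :: "nat set \<Rightarrow> nat \<Rightarrow> nat" where
  "site \<eta> k = sorted_list_of_set \<eta> ! k"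

definition neighbour :: "nat \<Rightarrow> nat \<Rightarrow> int \<Rightarrow> nat" where
  "neighbour L x d = nat ((int x + d) mod int L)"

definition moves :: "nat \<Rightarrow> nat set \<Rightarrow> nat set \<Rightarrow> (nat \<times> int) set" where
  "moves L \<eta> \<zeta> = {(x, d). x \<in> \<eta> \<and> d \<in> {1, -1} \<and> neighbour L x d \<notin> \<eta> \<and>
     \<zeta> = insert (neighbour L x d) (\<eta> - {x})}"

definition joined :: "nat \<Rightarrow> nat set \<Rightarrow> nat set \<Rightarrow> bool" where
  "joined L \<eta> \<zeta> \<longleftrightarrow> moves L \<eta> \<zeta> \<noteq> {}"

text \<open>Matrices are indexed by numbers, so the configurations are enumerated. The order in this
  list is immaterial.\<close>

definition config_list :: "nat \<Rightarrow> nat \<Rightarrow> nat set list" where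
  "config_list L N = filter (\<lambda>\<eta>. card \<eta> = N) (map set (subseqs [0..<L]))"

lemma distinct_config_list: "distinct (config_list L N)"
  unfolding config_list_def by (intro distinct_filter distinct_set_subseqs) simp

lemma set_config_list: "set (config_list L N) = configs L N"
  using subseqs_powset[of "[0..<L]"]
  by (auto simp: config_list_def configs_def atLeast0LessThan)

text \<open>The entry at \<open>\<eta>\<close>, \<open>\<zeta>\<close> counts the moves leading from \<open>\<eta>\<close> to \<open>\<zeta>\<close>.
  For \<open>L \<ge> 3\<close> this is the 0/1 adjacency matrix of the relation \<open>joined\<close>, see the lemma
  \<open>card_moves\<close> below. The two differ only for \<open>L = 2\<close>, \<open>N = 1\<close>, where the steps
  \<open>+1\<close> and \<open>-1\<close> lead to the same site and the edge of the cycle is double.\<close>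

definition adjacency_mat :: "nat \<Rightarrow> nat \<Rightarrow> complex mat" where
  "adjacency_mat L N = (let cs = config_list L N in
     mat (length cs) (length cs) (\<lambda>(i, j). of_nat (card (moves L (cs ! i) (cs ! j)))))"

text \<open>The function \<open>f\<close> on configurations as an element of the Hermitian space on which
  \<open>adjacency_mat\<close> acts.\<close>

definition config_vec :: "nat \<Rightarrow> nat \<Rightarrow> (nat set \<Rightarrow> complex) \<Rightarrow> complex vec" where
  "config_vec L N f = (let cs = config_list L N in vec (length cs) (\<lambda>i. f (cs ! i)))"

lemma neighbour_inj:
  assumes "L \<ge> 3" "d \<in> {1, -1}" "d' \<in> {1, -1}" "neighbour L x d = neighbour L x d'"
  shows "d = d'"
proof (rule ccontr)
  assume "d \<noteq> d'"
  then have "neighbour L x 1 = neighbour L x (-1)" using assms(2-4) by auto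
  then have "(int x + 1) mod int L = (int x + - 1) mod int L"
    using assms(1) by (simp add: neighbour_def eq_nat_nat_iff)
  then have "int L dvd (int x + 1) - (int x + - 1)" by (rule mod_eq_dvd_iff[THEN iffD1])
  then have "int L dvd 2" by simp
  then show False using zdvd_imp_le[of "int L" 2] assms(1) by simp
qed

lemma card_moves:
  assumes "L \<ge> 3"
  shows "card (moves L \<eta> \<zeta>) = (if joined L \<eta> \<zeta> then 1 else 0)"
proof (cases "joined L \<eta> \<zeta>")
  case True
  then obtain m where m: "m \<in> moves L \<eta> \<zeta>" unfolding joined_def by blast
  have "m' = m" if m': "m' \<in> moves L \<eta> \<zeta>" for m'
  proof -
    obtain x d x' d' where e: "m = (x, d)" "m' = (x', d')" by fastforce
    have D: "\<eta> - \<zeta> = {a} \<and> \<zeta> - \<eta> = {neighbour L a b} \<and> b \<in> {1, -1}"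
      if "(a, b) \<in> moves L \<eta> \<zeta>" for a b
    proof -
      have "a \<in> \<eta>" "neighbour L a b \<notin> \<eta>" "\<zeta> = insert (neighbour L a b) (\<eta> - {a})" "b \<in> {1, -1}"
        using that unfolding moves_def by auto
      moreover have "\<eta> - insert y (\<eta> - {a}) = {a}" "insert y (\<eta> - {a}) - \<eta> = {y}"
        if "a \<in> \<eta>" "y \<notin> \<eta>" for y
        using that by auto
      ultimately show ?thesis by simp
    qed
    note D1 = D[OF m[unfolded e]] and D2 = D[OF m'[unfolded e]]
    have x: "x' = x" using D1[THEN conjunct1] D2[THEN conjunct1] by (metis singleton_inject)
    have "{neighbour L x d} = {neighbour L x d'}"
      using D1[THEN conjunct2, THEN conjunct1] D2[THEN conjunct2, THEN conjunct1] x by metis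
    then have "neighbour L x d = neighbour L x d'" by (rule singleton_inject)
    then have "d = d'"
      using neighbour_inj[OF assms] D1[THEN conjunct2, THEN conjunct2] D2[THEN conjunct2, THEN conjunct2]
      by metis
    then show ?thesis using x e by simp
  qed
  then have "moves L \<eta> \<zeta> = {m}" using m by blast
  then show ?thesis using True by simp
next
  case False
  then show ?thesis by (simp add: joined_def)
qed

section \<open>Eigenfunctions\<close>

definition perron_eigenfunction :: "nat \<Rightarrow> nat \<Rightarrow> (nat set \<Rightarrow> real) \<Rightarrow> bool" where
  "perron_eigenfunction L N \<psi> \<longleftrightarrow>
     (\<forall>\<eta>\<in>configs L N. 0 < \<psi> \<eta>) \<and>
     (let v = config_vec L N (\<lambda>\<eta>. complex_of_real (\<psi> \<eta>)) in
       eigenvector (adjacency_mat L N) v (complex_of_real (spectral_radius (adjacency_mat L N))) \<and>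
       v \<bullet>c v = 1)"

definition orthonormal_basis :: "nat \<Rightarrow> complex vec set \<Rightarrow> bool" where
  "orthonormal_basis n B \<longleftrightarrow>
     vectorspace.basis class_ring (module_vec TYPE(complex) n) B \<and>
     (\<forall>u\<in>B. \<forall>v\<in>B. u \<bullet>c v = (if u = v then 1 else 0))"

definition momentum_shift :: "nat \<Rightarrow> real" where
  "momentum_shift N = (if odd N then 0 else 1 / 2)"

definition psi :: "nat \<Rightarrow> nat \<Rightarrow> nat set \<Rightarrow> (nat \<Rightarrow> real) \<Rightarrow> complex" where
  "psi L N \<xi> y = 1 / complex_of_real (real L powr (real N / 2)) *
     det (mat N N (\<lambda>(k, j).
       exp (2 * \<i> * complex_of_real pi * complex_of_real (real (site \<xi> k) + momentum_shift N)
            * complex_of_real (y j) / of_nat L)))"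

definition psi_on :: "nat \<Rightarrow> nat \<Rightarrow> nat set \<Rightarrow> nat set \<Rightarrow> complex" where
  "psi_on L N \<xi> \<eta> = psi L N \<xi> (\<lambda>j. real (site \<eta> j))"

definition rho :: "nat \<Rightarrow> nat \<Rightarrow> nat set \<Rightarrow> real" where
  "rho L N \<xi> = 2 * (\<Sum>i<N. cos (2 * pi * (real (site \<xi> i) + momentum_shift N) / real L))"

definition compact_config :: "nat \<Rightarrow> nat \<Rightarrow> nat set" where
  "compact_config L N = (let p = N div 2 in
     if odd N then {0..p} \<union> {L - p..<L} else {0..<p} \<union> {L - p..<L})"

lemma compact_config_in_configs:
  assumes "1 \<le> N" "N \<le> L - 1"
  shows "compact_config L N \<in> configs L N"
proof -
  define p where "p = N div 2"
  show ?thesis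
  proof (cases "odd N")
    case True
    then have N: "N = 2 * p + 1" unfolding p_def by presburger
    have "card ({0..p} \<union> {L - p..<L}) = card {0..p} + card {L - p..<L}"
      by (rule card_Un_disjoint) (use N assms in auto)
    then show ?thesis using True N assms
      by (auto simp: compact_config_def configs_def Let_def p_def[symmetric])
  next
    case False
    then have N: "N = 2 * p" unfolding p_def by presburger
    have "card ({0..<p} \<union> {L - p..<L}) = card {0..<p} + card {L - p..<L}"
      by (rule card_Un_disjoint) (use N assms in auto)
    then show ?thesis using False N assms
      by (auto simp: compact_config_def configs_def Let_def p_def[symmetric])
  qed
qed

end

theory Submission
  imports Defs
begin

text \<open>The particles are free fermions. For increasing \<open>\<eta>\<close>, \<open>\<psi>\<^sub>\<xi>(\<eta>)\<close> is a multiple of a Slater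
  determinant of plane waves, which makes sense at every integer tuple \<open>y\<close>. Moving each
  coordinate in turn by \<open>+1\<close> and \<open>-1\<close> and adding up multiplies the determinant by \<open>\<rho>\<^sub>\<xi>\<close>, because
  every term of its Leibniz expansion is a product of eigenfunctions of the discrete Laplacian
  (\<open>slater_hop_sum\<close>). A forbidden move produces two coordinates that agree modulo \<open>L\<close>, and
  there the determinant vanishes (\<open>slater_collision\<close>). So \<open>\<psi>\<^sub>\<xi>\<close> is an eigenfunction of \<open>A\<close>
  as soon as the determinant at the tuple after an allowed move equals the one at its sorted
  residues modulo \<open>L\<close>.

  Only moves across the bond between \<open>L - 1\<close> and \<open>0\<close> are delicate there: sorting
  the residues then takes a cyclic permutation, and the shift \<open>\<gamma>\<close> gives the waves of the crossing
  particle a sign that cancels the sign of this permutation. No sign has to be computed, however. Permuting the coordinates and shifting them by multiples of \<open>L\<close>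
  multiplies the determinants of all \<open>\<xi>\<close> by one and the same number \<open>\<kappa>\<close> of modulus 1
  (\<open>slater_permute_shift\<close>). For the compact configuration the Vandermonde formula evaluates
  the determinant as a constant times a product of sines (\<open>slater_compact\<close>), and this product is
  positive both at the tuple after the move and at the sorted one. Hence \<open>\<kappa> = 1\<close>
  (\<open>slater_eq_sorted\<close>).

  Orthonormality is the Cauchy-Binet formula (\<open>cauchy_binet\<close>): the sum over configurations of
  a product of two determinants is the determinant of the Gram matrix of the plane waves, which
  are orthogonal on the cycle. As there are as many \<open>\<psi>\<^sub>\<xi>\<close> as configurations, they form a basis
  and the \<open>\<rho>\<^sub>\<xi>\<close> exhaust the spectrum.

  The product of sines is positive on every configuration, so \<open>\<psi>\<^sub>c\<close> is, up to a phase, a positive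
  eigenfunction. A positive eigenfunction of a nonnegative matrix belongs to the spectral
  radius (\<open>eigenvalue_norm_le_positive_eigenvalue\<close>), and it is unique up to a factor because the
  graph is connected (\<open>positive_eigenfunction_unique\<close>, \<open>configs_connected\<close>).\<close>

section \<open>Configurations and increasing tuples\<close>

lemma site_strict_mono:
  assumes "\<eta> \<in> configs L N" "i < j" "j < N"
  shows "site \<eta> i < site \<eta> j"
proof -
  have "finite \<eta>" "card \<eta> = N"
    using assms(1) finite_subset[of \<eta> "{..<L}"] by (auto simp: configs_def)
  then show ?thesis
    using assms(2,3) sorted_wrt_nth_less[OF strict_sorted_list_of_set[of \<eta>], of i j]
    by (simp add: site_def)
qed

lemma bij_betw_site:
  assumes "\<eta> \<in> configs L N"
  shows "bij_betw (site \<eta>) {0..<N} \<eta>"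
proof -
  have "finite \<eta>" "card \<eta> = N"
    using assms(1) finite_subset[of \<eta> "{..<L}"] by (auto simp: configs_def)
  then show ?thesis
    using bij_betw_nth[of "sorted_list_of_set \<eta>" "{0..<N}" \<eta>]
    by (simp add: site_def[abs_def] atLeast0LessThan)
qed

lemma site_less:
  assumes "\<eta> \<in> configs L N" "i < N"
  shows "site \<eta> i < L"
  using bij_betwE[OF bij_betw_site[OF assms(1)]] assms by (auto simp: configs_def)

lemma finite_configs: "finite (configs L N)"
  by (rule finite_subset[of _ "Pow {..<L}"]) (auto simp: configs_def)

lemma move_in_configs:
  assumes "\<eta> \<in> configs L N" "x \<in> \<eta>" "y < L" "y \<notin> \<eta>"
  shows "insert y (\<eta> - {x}) \<in> configs L N"
proof -
  have "finite \<eta>" using assms(1) finite_subset[of \<eta> "{..<L}"] by (auto simp: configs_def)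
  moreover have "card \<eta> > 0" using calculation assms(2) by (auto simp: card_gt_0_iff)
  ultimately show ?thesis using assms by (auto simp: configs_def)
qed

lemma permutes_nat_lt: "p permutes {0..<(n::nat)} \<Longrightarrow> k < n \<Longrightarrow> p k < n"
  using permutes_in_image[of p "{0..<n}" k] by auto

lemma configs_sort_permutation:
  assumes "inj_on w {0..<N}" "w ` {0..<N} = \<zeta>" "\<zeta> \<in> configs L N"
  obtains \<sigma> where "\<sigma> permutes {0..<N}" "\<And>j. j < N \<Longrightarrow> w j = site \<zeta> (\<sigma> j)"
proof -
  note b = bij_betw_site[OF assms(3)]
  have w: "bij_betw w {0..<N} \<zeta>" using assms(1,2) by (simp add: bij_betw_def)
  let ?g = "inv_into {0..<N} (site \<zeta>)"
  define \<sigma> where "\<sigma> j = (if j \<in> {0..<N} then (?g \<circ> w) j else j)" for j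
  have "bij_betw (?g \<circ> w) {0..<N} {0..<N}"
    by (rule bij_betw_trans[OF w bij_betw_inv_into[OF b]])
  then have "bij_betw \<sigma> {0..<N} {0..<N}"
    by (rule bij_betw_cong[THEN iffD1, rotated]) (simp add: \<sigma>_def)
  then have 1: "\<sigma> permutes {0..<N}"
    by (rule bij_imp_permutes) (simp add: \<sigma>_def)
  have 2: "w j = site \<zeta> (\<sigma> j)" if "j < N" for j
    using that bij_betw_inv_into_right[OF b, of "w j"] assms(2) by (auto simp: \<sigma>_def)
  show ?thesis using that 1 2 by blast
qed

section \<open>Determinants\<close>

lemma det_permute_columns:
  assumes A: "A \<in> carrier_mat n n" and p: "p permutes {0..<n}"
  shows "det (mat n n (\<lambda>(i, j). A $$ (i, p j))) = signof p * det A"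
proof -
  have "mat n n (\<lambda>(i, j). A $$ (i, p j)) =
      transpose_mat (mat n n (\<lambda>(i, j). transpose_mat A $$ (p i, j)))"
    using A permutes_in_image[OF p] by (intro eq_matI) auto
  then show ?thesis
    using det_permute_rows[of "transpose_mat A" n p] A p
    by (simp add: det_transpose[of _ n])
qed

text \<open>Expanding the left-hand determinant gives a sum over all maps \<open>y\<close> from rows to \<open>{..<L}\<close> of
  \<open>\<Prod>\<^sub>k A k (y k)\<close> times the determinant of the rows \<open>y k\<close> of \<open>B\<close>. The second factor vanishes
  unless \<open>y\<close> is injective, and an injective \<open>y\<close> is a configuration together with a permutation of
  its sites. Summing over the permutations restores the determinant of the columns of \<open>A\<close>.\<close>

lemma cauchy_binet:
  fixes A B :: "nat \<Rightarrow> nat \<Rightarrow> 'a :: comm_ring_1"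
  shows "det (mat N N (\<lambda>(k, l). \<Sum>m<L. A k m * B m l)) =
    (\<Sum>\<eta>\<in>configs L N. det (mat N N (\<lambda>(k, j). A k (site \<eta> j))) *
       det (mat N N (\<lambda>(j, l). B (site \<eta> j) l)))"
proof -
  let ?U = "{0..<N}" and ?F = "{0..<N} \<rightarrow>\<^sub>E {..<L}"
  let ?P = "{p. p permutes ?U}"
  let ?D = "\<lambda>y. det (mat N N (\<lambda>(j, l). B (y j) l))"
  let ?t = "\<lambda>y. (\<Prod>k=0..<N. A k (y k)) * ?D y"
  have "det (mat N N (\<lambda>(k, l). \<Sum>m<L. A k m * B m l)) =
      (\<Sum>p\<in>?P. signof p * (\<Prod>k=0..<N. \<Sum>m<L. A k m * B m (p k)))"
    by (subst det_def'[of _ N])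
      (auto intro!: sum.cong prod.cong simp: permutes_nat_lt)
  also have "\<dots> = (\<Sum>p\<in>?P. signof p * (\<Sum>y\<in>?F. \<Prod>k=0..<N. A k (y k) * B (y k) (p k)))"
    by (intro sum.cong arg_cong2[of _ _ _ _ "(*)"] prod_sum_PiE refl) auto
  also have "\<dots> = (\<Sum>y\<in>?F. \<Sum>p\<in>?P. signof p * (\<Prod>k=0..<N. A k (y k) * B (y k) (p k)))"
    by (simp add: sum_distrib_left) (rule sum.swap)
  also have "\<dots> = (\<Sum>y\<in>?F. ?t y)"
  proof (rule sum.cong)
    fix y assume "y \<in> ?F"
    have "?D y = (\<Sum>p\<in>?P. signof p * (\<Prod>k=0..<N. B (y k) (p k)))"
      by (subst det_def'[of _ N])
        (auto intro!: sum.cong prod.cong simp: permutes_nat_lt)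
    then show "(\<Sum>p\<in>?P. signof p * (\<Prod>k=0..<N. A k (y k) * B (y k) (p k))) = ?t y"
      by (simp add: prod.distrib sum_distrib_left mult_ac)
  qed simp
  also have "\<dots> = (\<Sum>y\<in>{y\<in>?F. inj_on y ?U}. ?t y)"
  proof (rule sum.mono_neutral_right)
    show "\<forall>y\<in>?F - {y\<in>?F. inj_on y ?U}. ?t y = 0"
    proof
      fix y assume "y \<in> ?F - {y\<in>?F. inj_on y ?U}"
      then obtain i j where "i < N" "j < N" "i \<noteq> j" "y i = y j"
        by (auto simp: inj_on_def)
      then have "?D y = 0"
        by (intro det_identical_rows[of _ N i j]) (auto intro!: eq_vecI)
      then show "?t y = 0" by simp
    qed
  qed (auto intro: finite_PiE)
  also have "\<dots> = (\<Sum>(\<eta>, \<sigma>)\<in>configs L N \<times> ?P. ?t (\<lambda>k. site \<eta> (\<sigma> k)))"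
  proof -
    let ?r = "\<lambda>(\<eta>, \<sigma>). restrict (site \<eta> \<circ> \<sigma>) ?U"
    have img: "?r (\<eta>, \<sigma>) ` ?U = \<eta>" if "\<eta> \<in> configs L N" "\<sigma> \<in> ?P" for \<eta> \<sigma>
    proof -
      have "?r (\<eta>, \<sigma>) ` ?U = site \<eta> ` \<sigma> ` ?U" by (auto simp: image_iff)
      then show ?thesis
        using bij_betw_site[OF that(1)] permutes_image[of \<sigma> ?U] that(2)
        by (simp add: bij_betw_def)
    qed
    have bij: "bij_betw ?r (configs L N \<times> ?P) {y\<in>?F. inj_on y ?U}"
      unfolding bij_betw_def
    proof (intro conjI equalityI subsetI)
      show "inj_on ?r (configs L N \<times> ?P)"
      proof (rule inj_onI, clarify)
        fix \<eta> \<sigma> \<zeta> \<tau> assume h: "\<eta> \<in> configs L N" "\<sigma> permutes ?U" "\<zeta> \<in> configs L N" "\<tau> permutes ?U"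
          "restrict (site \<eta> \<circ> \<sigma>) ?U = restrict (site \<zeta> \<circ> \<tau>) ?U"
        have "\<eta> = \<zeta>" using img[of \<eta> \<sigma>] img[of \<zeta> \<tau>] h by simp
        moreover have "\<sigma> k = \<tau> k" for k
        proof (cases "k < N")
          case True
          then have "site \<eta> (\<sigma> k) = site \<eta> (\<tau> k)"
            using fun_cong[OF h(5), of k] \<open>\<eta> = \<zeta>\<close> by simp
          then show ?thesis
            using bij_betw_site[OF h(1)] permutes_in_image[OF h(2), of k]
              permutes_in_image[OF h(4), of k] True
            by (auto simp: bij_betw_def inj_on_def)
        next
          case False
          then show ?thesis using h by (simp add: permutes_def)
        qed
        ultimately show "\<eta> = \<zeta> \<and> \<sigma> = \<tau>" by auto
      qed
    next
      fix y assume "y \<in> ?r ` (configs L N \<times> ?P)"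
      then obtain \<eta> \<sigma> where h: "\<eta> \<in> configs L N" "\<sigma> permutes ?U"
        "y = restrict (site \<eta> \<circ> \<sigma>) ?U" by auto
      have "inj_on (site \<eta> \<circ> \<sigma>) ?U"
        using bij_betw_site[OF h(1)] permutes_imp_bij[OF h(2)] bij_betw_trans bij_betw_def
        by metis
      then have "inj_on y ?U" unfolding h by (simp add: inj_on_def)
      moreover have "y \<in> ?F" using h site_less permutes_in_image[OF h(2)] by (auto simp: h(3))
      ultimately show "y \<in> {y\<in>?F. inj_on y ?U}" by simp
    next
      fix y assume "y \<in> {y\<in>?F. inj_on y ?U}"
      then have y: "y \<in> ?F" "inj_on y ?U" by auto
      then have \<eta>: "y ` ?U \<in> configs L N" by (auto simp: configs_def card_image)
      from configs_sort_permutation[OF y(2) refl \<eta>] obtain \<sigma> where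
        s: "\<sigma> permutes ?U" "\<And>j. j < N \<Longrightarrow> y j = site (y ` ?U) (\<sigma> j)" by blast
      have "y = ?r (y ` ?U, \<sigma>)"
        using s(2) y(1) by (auto simp: fun_eq_iff PiE_def extensional_def)
      then show "y \<in> ?r ` (configs L N \<times> ?P)" using \<eta> s(1) by blast
    qed
    have D: "?D (restrict y ?U) = ?D y" for y
      by (intro arg_cong[of _ _ det] eq_matI) auto
    have "?t (?r z) = (case z of (\<eta>, \<sigma>) \<Rightarrow> ?t (\<lambda>k. site \<eta> (\<sigma> k)))" for z
      by (cases z) (simp only: prod.case D, simp add: comp_def)
    then show ?thesis using sum.reindex_bij_betw[OF bij, of ?t] by simp
  qed
  also have "\<dots> = (\<Sum>\<eta>\<in>configs L N. \<Sum>\<sigma>\<in>?P. ?t (\<lambda>k. site \<eta> (\<sigma> k)))"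
    by (simp add: sum.cartesian_product)
  also have "\<dots> = (\<Sum>\<eta>\<in>configs L N. det (mat N N (\<lambda>(k, j). A k (site \<eta> j))) * ?D (site \<eta>))"
  proof (rule sum.cong)
    fix \<eta> assume "\<eta> \<in> configs L N"
    have "?t (\<lambda>k. site \<eta> (\<sigma> k)) =
        (signof \<sigma> * (\<Prod>k=0..<N. A k (site \<eta> (\<sigma> k)))) * ?D (site \<eta>)" if "\<sigma> \<in> ?P" for \<sigma>
    proof -
      have "mat N N (\<lambda>(j, l). B (site \<eta> (\<sigma> j)) l) =
          mat N N (\<lambda>(j, l). mat N N (\<lambda>(j, l). B (site \<eta> j) l) $$ (\<sigma> j, l))"
        using that by (intro eq_matI) (auto simp: permutes_nat_lt)
      then show ?thesis
        using det_permute_rows[of "mat N N (\<lambda>(j, l). B (site \<eta> j) l)" N \<sigma>] that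
        by (simp add: mult_ac)
    qed
    moreover have "det (mat N N (\<lambda>(k, j). A k (site \<eta> j))) =
        (\<Sum>\<sigma>\<in>?P. signof \<sigma> * (\<Prod>k=0..<N. A k (site \<eta> (\<sigma> k))))"
      by (subst det_def'[of _ N]) (auto intro!: sum.cong prod.cong simp: permutes_nat_lt)
    ultimately show "(\<Sum>\<sigma>\<in>?P. ?t (\<lambda>k. site \<eta> (\<sigma> k))) =
        det (mat N N (\<lambda>(k, j). A k (site \<eta> j))) * ?D (site \<eta>)"
      by (simp add: sum_distrib_right)
  qed simp
  finally show ?thesis .
qed

text \<open>Multiplication from the left by the unitriangular matrix of coefficients of the Newton
  polynomials \<open>q\<^sub>k(t) = \<Prod>\<^sub>i\<^sub><\<^sub>k (t - x\<^sub>i)\<close> turns the Vandermonde matrix into the matrix of the values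
  \<open>q\<^sub>k(x\<^sub>j)\<close>. That one is upper triangular, since \<open>q\<^sub>k\<close> vanishes at \<open>x\<^sub>j\<close> for \<open>j < k\<close>.\<close>

lemma vandermonde_det:
  fixes x :: "nat \<Rightarrow> 'a :: idom"
  shows "det (mat n n (\<lambda>(k, j). x j ^ k)) = (\<Prod>j<n. \<Prod>i<j. x j - x i)"
proof -
  define q where "q k = (\<Prod>i<k. [:- x i, 1:])" for k
  have mon: "monic (q k)" for k unfolding q_def by (rule monic_prod) auto
  have deg: "degree (q k) = k" for k
    unfolding q_def by (subst degree_prod_eq_sum_degree) auto
  define T where "T = mat n n (\<lambda>(k, l). coeff (q k) l)"
  let ?V = "mat n n (\<lambda>(k, j). x j ^ k)"
  have T: "T \<in> carrier_mat n n" by (simp add: T_def)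
  have "T * ?V = mat n n (\<lambda>(k, j). poly (q k) (x j))"
  proof (rule eq_matI)
    fix k j assume "k < dim_row (mat n n (\<lambda>(k, j). poly (q k) (x j)))"
      "j < dim_col (mat n n (\<lambda>(k, j). poly (q k) (x j)))"
    then have kj: "k < n" "j < n" by auto
    have "poly (q k) (x j) = (\<Sum>l<n. coeff (q k) l * x j ^ l)"
      unfolding poly_altdef
      by (rule sum.mono_neutral_left) (use kj in \<open>auto simp: deg coeff_eq_0\<close>)
    then show "(T * ?V) $$ (k, j) = mat n n (\<lambda>(k, j). poly (q k) (x j)) $$ (k, j)"
      using kj by (simp add: T_def scalar_prod_def atLeast0LessThan)
  qed (auto simp: T_def)
  moreover have "det T = 1"
  proof -
    have "det T = prod_list (diag_mat T)"
      by (rule det_lower_triangular[OF _ T]) (simp add: T_def coeff_eq_0 deg)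
    also have "\<dots> = (\<Prod>k=0..<n. T $$ (k, k))" by (simp add: prod_list_diag_prod T_def)
    also have "\<dots> = 1" using mon by (intro prod.neutral) (auto simp: T_def deg)
    finally show ?thesis .
  qed
  moreover have "det (mat n n (\<lambda>(k, j). poly (q k) (x j))) = (\<Prod>j<n. \<Prod>i<j. x j - x i)"
  proof -
    let ?R = "mat n n (\<lambda>(k, j). poly (q k) (x j))"
    have "det ?R = prod_list (diag_mat ?R)"
      by (rule det_upper_triangular[of _ n]) (auto simp: upper_triangular_def q_def poly_prod)
    also have "\<dots> = (\<Prod>k=0..<n. ?R $$ (k, k))" by (simp add: prod_list_diag_prod)
    also have "\<dots> = (\<Prod>j<n. \<Prod>i<j. x j - x i)"
      by (auto intro!: prod.cong simp: q_def poly_prod atLeast0LessThan)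
    finally show ?thesis .
  qed
  ultimately show ?thesis using det_mult[OF T, of ?V] by simp
qed

section \<open>Slater determinants of plane waves\<close>

text \<open>The coordinates are arbitrary integers, neither ordered nor confined to \<open>{..<L}\<close>, so that a
  particle can be moved without leaving the domain of definition.\<close>

definition slater :: "nat \<Rightarrow> nat \<Rightarrow> (nat \<Rightarrow> real) \<Rightarrow> (nat \<Rightarrow> int) \<Rightarrow> complex" where
  "slater L N a y = det (mat N N (\<lambda>(k, j). cis (2 * pi * a k * of_int (y j) / real L)))"

definition sine_product :: "nat \<Rightarrow> nat \<Rightarrow> (nat \<Rightarrow> int) \<Rightarrow> real" where
  "sine_product L N y = (\<Prod>j<N. \<Prod>i<j. sin (of_int (y j - y i) * pi / real L))"

lemma slater_leibniz:
  "slater L N a y = (\<Sum>p | p permutes {0..<N}.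
     signof p * (\<Prod>j<N. cis (2 * pi * a (p j) * of_int (y j) / real L)))"
  unfolding slater_def
  by (subst det_col[of _ N]) (auto intro!: sum.cong prod.cong simp: permutes_nat_lt)

lemma cnj_slater: "cnj (slater L N a y) = slater L N (\<lambda>k. - a k) y"
  by (simp add: slater_leibniz cis_cnj)

text \<open>Each Leibniz term is a product of one wave per coordinate; moving the coordinate \<open>j\<close> by \<open>\<plusminus>1\<close>
  multiplies it by \<open>e\<^sup>\<plusminus>\<^sup>i\<^sup>t\<close> where \<open>t\<close> is the phase that the wave in that coordinate gains per site, and the sum of
  the resulting cosines over \<open>j\<close> does not depend on the permutation.\<close>

lemma slater_hop_sum:
  "(\<Sum>j<N. slater L N a (y(j := y j + 1)) + slater L N a (y(j := y j - 1))) =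
   of_real (2 * (\<Sum>k<N. cos (2 * pi * a k / real L))) * slater L N a y"
proof -
  let ?e = "\<lambda>p z. \<Prod>j<N. cis (2 * pi * a (p j) * of_int (z j) / real L)"
  let ?P = "{p. p permutes {0..<N}}"
  have upd: "?e p (y(j := y j + d)) = ?e p y * cis (2 * pi * a (p j) * of_int d / real L)"
    if "j < N" for p j d
  proof -
    have "(\<Prod>i\<in>{..<N} - {j}. cis (2 * pi * a (p i) * of_int ((y(j := y j + d)) i) / real L)) =
        (\<Prod>i\<in>{..<N} - {j}. cis (2 * pi * a (p i) * of_int (y i) / real L))"
      by (intro prod.cong) auto
    then show ?thesis
      using that by (simp add: prod.remove[of "{..<N}" j] cis_mult ring_distribs add_divide_distrib)
  qed
  have two: "cis t + cis (- t) = of_real (2 * cos t)" for t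
    by (simp add: complex_eq_iff)
  have pair: "?e p (y(j := y j + 1)) + ?e p (y(j := y j - 1)) =
      ?e p y * of_real (2 * cos (2 * pi * a (p j) / real L))" if "j < N" for p j
    using upd[OF that, of p 1] upd[OF that, of p "-1"] two[of "2 * pi * a (p j) / real L"]
    by (simp add: distrib_left[symmetric])
  have "(\<Sum>j<N. slater L N a (y(j := y j + 1)) + slater L N a (y(j := y j - 1))) =
      (\<Sum>j<N. \<Sum>p\<in>?P. signof p * (?e p y * of_real (2 * cos (2 * pi * a (p j) / real L))))"
    unfolding slater_leibniz sum.distrib[symmetric] distrib_left[symmetric]
    by (intro sum.cong refl arg_cong2[of _ _ _ _ "(*)"] pair) simp
  also have "\<dots> = (\<Sum>p\<in>?P. signof p * ?e p y * of_real (2 * (\<Sum>j<N. cos (2 * pi * a (p j) / real L))))"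
    by (subst sum.swap) (simp add: sum_distrib_left mult_ac)
  also have "\<dots> = (\<Sum>p\<in>?P. signof p * ?e p y * of_real (2 * (\<Sum>k<N. cos (2 * pi * a k / real L))))"
  proof (rule sum.cong)
    fix p assume "p \<in> ?P"
    then have "bij_betw p {..<N} {..<N}" by (simp add: permutes_imp_bij atLeast0LessThan)
    from sum.reindex_bij_betw[OF this, of "\<lambda>k. cos (2 * pi * a k / real L)"]
    show "signof p * ?e p y * of_real (2 * (\<Sum>j<N. cos (2 * pi * a (p j) / real L))) =
        signof p * ?e p y * of_real (2 * (\<Sum>k<N. cos (2 * pi * a k / real L)))" by simp
  qed simp
  also have "\<dots> = of_real (2 * (\<Sum>k<N. cos (2 * pi * a k / real L))) * slater L N a y"
    unfolding slater_leibniz by (simp add: sum_distrib_left mult_ac)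
  finally show ?thesis .
qed

text \<open>The factor depends on the momenta \<open>a\<close> only through their common fractional part \<open>g\<close>: it is the
  same for all configurations \<open>\<xi>\<close>.\<close>

lemma slater_permute_shift:
  assumes "L > 0" "\<sigma> permutes {0..<N}"
    and y: "\<And>j. j < N \<Longrightarrow> y j = z (\<sigma> j) + int L * n j"
    and a: "\<And>k. k < N \<Longrightarrow> a k = of_int (b k) + g"
  shows "slater L N a y =
    signof \<sigma> * (\<Prod>j<N. cis (2 * pi * g * of_int (n j))) * slater L N a z"
proof -
  let ?M = "mat N N (\<lambda>(k, j). cis (2 * pi * a k * of_int (z j) / real L))"
  have e: "cis (2 * pi * a k * of_int (y j) / real L) =
      cis (2 * pi * g * of_int (n j)) * cis (2 * pi * a k * of_int (z (\<sigma> j)) / real L)"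
    if "k < N" "j < N" for k j
  proof -
    have "2 * pi * a k * of_int (y j) / real L =
        2 * pi * a k * of_int (z (\<sigma> j)) / real L + 2 * pi * g * of_int (n j) +
        2 * pi * of_int (b k * n j)"
      using that assms(1) by (simp add: y a field_simps)
    moreover have "cis (2 * pi * of_int (b k * n j)) = 1" by (rule cis_multiple_2pi) simp
    ultimately show ?thesis by (simp only: cis_mult[symmetric]) simp
  qed
  have "slater L N a y = (\<Sum>p | p permutes {0..<N}. signof p *
      (\<Prod>j<N. cis (2 * pi * g * of_int (n j)) * cis (2 * pi * a (p j) * of_int (z (\<sigma> j)) / real L)))"
    unfolding slater_leibniz
    by (intro sum.cong arg_cong2[of _ _ _ _ "(*)"] prod.cong refl e) (auto simp: permutes_nat_lt)
  also have "\<dots> = (\<Prod>j<N. cis (2 * pi * g * of_int (n j))) *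
      slater L N a (\<lambda>j. z (\<sigma> j))"
    by (simp add: slater_leibniz prod.distrib sum_distrib_left mult_ac)
  also have "slater L N a (\<lambda>j. z (\<sigma> j)) = det (mat N N (\<lambda>(k, j). ?M $$ (k, \<sigma> j)))"
    unfolding slater_def
    by (intro arg_cong[of _ _ det] cong_mat) (auto simp: permutes_nat_lt[OF assms(2)])
  also have "\<dots> = signof \<sigma> * slater L N a z"
    using det_permute_columns[of ?M N \<sigma>] assms(2) by (simp add: slater_def)
  finally show ?thesis by (simp add: mult_ac)
qed

text \<open>Up to a phase the columns \<open>i\<close> and \<open>j\<close> coincide.\<close>

lemma slater_collision:
  assumes "L > 0" "i < N" "j < N" "i \<noteq> j" "y j = y i + int L * n"
    and a: "\<And>k. k < N \<Longrightarrow> a k = of_int (b k) + g"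
  shows "slater L N a y = 0"
proof -
  \<comment> \<open>\<open>y\<close> is a shift of a tuple with two equal coordinates.\<close>
  let ?z = "y(j := y i)"
  let ?M = "mat N N (\<lambda>(k, j). cis (2 * pi * a k * of_int (?z j) / real L))"
  have "det ?M = 0"
    by (rule det_identical_columns[of _ N i j]) (use assms in \<open>auto intro!: eq_vecI\<close>)
  then have "slater L N a ?z = 0" by (simp add: slater_def)
  moreover have "slater L N a y = signof id *
      (\<Prod>l<N. cis (2 * pi * g * of_int (if l = j then n else 0))) * slater L N a ?z"
    by (rule slater_permute_shift) (use assms in \<open>auto simp: permutes_id\<close>)
  ultimately show ?thesis by simp
qed

section \<open>The compact configuration\<close>

lemma prod_pairs_mult:
  fixes f :: "nat \<Rightarrow> 'a :: comm_monoid_mult"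
  shows "(\<Prod>j<n. \<Prod>i<j. f i * f j) = (\<Prod>j<n. f j ^ (n - 1))"
proof (induction n)
  case (Suc n)
  have "(\<Prod>j<n. f j ^ (n - 1)) * (\<Prod>i<n. f i) = (\<Prod>j<n. f j ^ n)"
    by (cases n) (simp_all add: prod.distrib mult_ac)
  moreover have "(\<Prod>j<Suc n. \<Prod>i<j. f i * f j) =
      (\<Prod>j<n. f j ^ (n - 1)) * (\<Prod>i<n. f i) * f n ^ n"
    unfolding prod.lessThan_Suc Suc.IH by (simp add: prod.distrib mult_ac)
  ultimately show ?case by simp
qed simp

text \<open>With \<open>x\<^sub>j = cis (2\<pi> y\<^sub>j / L)\<close> and \<open>h\<^sub>j\<close> the corresponding half phase, the determinant is the Vandermonde
  determinant of the \<open>x\<^sub>j\<close> divided by \<open>\<Prod>\<^sub>j h\<^sub>j\<^sup>N\<^sup>-\<^sup>1\<close>. Each difference \<open>x\<^sub>j - x\<^sub>i\<close> is \<open>2i h\<^sub>i h\<^sub>j\<close> times a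
  sine, and the half phases cancel exactly because the momenta are centred at \<open>0\<close>.\<close>

lemma slater_centred:
  assumes "L > 0"
  shows "slater L N (\<lambda>k. real k - (real N - 1) / 2) y =
    (2 * \<i>) ^ (N * (N - 1) div 2) * of_real (sine_product L N y)"
proof (cases "N = 0")
  case True
  then show ?thesis by (simp add: slater_def sine_product_def)
next
  case False
  define x where "x j = cis (2 * pi * of_int (y j) / real L)" for j
  define h where "h j = cis (pi * of_int (y j) / real L)" for j
  have diff: "x j - x i = 2 * \<i> * of_real (sin (of_int (y j - y i) * pi / real L)) * (h i * h j)"
    for i j
  proof -
    define s t where "s = pi * of_int (y i) / real L" and "t = pi * of_int (y j) / real L"
    have "cis (2 * t) - cis (2 * s) = (cis (t - s) - cis (- (t - s))) * (cis s * cis t)"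
      by (simp add: cis_mult left_diff_distrib)
    also have "cis d - cis (- d) = 2 * \<i> * of_real (sin d)" for d
      by (simp add: complex_eq_iff)
    also have "t - s = of_int (y j - y i) * pi / real L"
      by (simp add: s_def t_def diff_divide_distrib[symmetric] algebra_simps)
    finally show ?thesis by (simp add: x_def h_def s_def t_def mult_ac)
  qed
  have count: "(\<Prod>j<n. \<Prod>i<j. c) = c ^ (n * (n - 1) div 2)" for n and c :: complex
  proof (induction n)
    case (Suc n)
    have "Suc n * (Suc n - 1) div 2 = n * (n - 1) div 2 + n"
      by (cases n) (simp_all add: algebra_simps)
    then show ?case by (simp only: prod.lessThan_Suc Suc.IH power_add) simp
  qed simp
  have "cis (2 * pi * (real k - (real N - 1) / 2) * of_int (y j) / real L) =
      x j ^ k * inverse (h j ^ (N - 1))" for k j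
  proof -
    have "2 * pi * (real k - (real N - 1) / 2) * of_int (y j) / real L =
        real k * (2 * pi * of_int (y j) / real L) + - (real (N - 1) * (pi * of_int (y j) / real L))"
      using False assms by (simp add: field_simps of_nat_diff)
    then show ?thesis by (simp only: x_def h_def DeMoivre cis_inverse cis_mult)
  qed
  then have "slater L N (\<lambda>k. real k - (real N - 1) / 2) y = (\<Sum>p | p permutes {0..<N}.
      signof p * (\<Prod>j<N. x j ^ p j * inverse (h j ^ (N - 1))))"
    by (simp add: slater_leibniz)
  also have "\<dots> = (\<Prod>j<N. inverse (h j ^ (N - 1))) *
      (\<Sum>p | p permutes {0..<N}. signof p * (\<Prod>j<N. x j ^ p j))"
    by (simp add: prod.distrib sum_distrib_left mult_ac)
  also have "(\<Sum>p | p permutes {0..<N}. signof p * (\<Prod>j<N. x j ^ p j)) =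
      det (mat N N (\<lambda>(k, j). x j ^ k))"
    by (subst det_col[of _ N]) (auto intro!: sum.cong prod.cong simp: permutes_nat_lt)
  also have "\<dots> = (\<Prod>j<N. \<Prod>i<j. x j - x i)" by (rule vandermonde_det)
  also have "\<dots> = (\<Prod>j<N. \<Prod>i<j. 2 * \<i>) *
      (\<Prod>j<N. \<Prod>i<j. of_real (sin (of_int (y j - y i) * pi / real L))) *
      (\<Prod>j<N. \<Prod>i<j. h i * h j)"
    unfolding diff by (simp only: prod.distrib mult_ac)
  also have "\<dots> = (2 * \<i>) ^ (N * (N - 1) div 2) * of_real (sine_product L N y) *
      (\<Prod>j<N. h j ^ (N - 1))"
    unfolding count prod_pairs_mult by (simp add: sine_product_def)
  also have "(\<Prod>j<N. inverse (h j ^ (N - 1))) * ((2 * \<i>) ^ (N * (N - 1) div 2) *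
      of_real (sine_product L N y) * (\<Prod>j<N. h j ^ (N - 1))) =
      (2 * \<i>) ^ (N * (N - 1) div 2) * of_real (sine_product L N y) *
      (\<Prod>j<N. inverse (h j ^ (N - 1)) * h j ^ (N - 1))"
    by (simp only: prod.distrib mult_ac)
  also have "(\<Prod>j<N. inverse (h j ^ (N - 1)) * h j ^ (N - 1)) = 1"
    by (intro prod.neutral) (simp add: h_def)
  finally show ?thesis by simp
qed

definition momentum :: "nat \<Rightarrow> nat set \<Rightarrow> nat \<Rightarrow> real" where
  "momentum N \<xi> k = real (site \<xi> k) + momentum_shift N"

lemma momentum_int: "momentum N \<xi> k = of_int (int (site \<xi> k)) + momentum_shift N"
  by (simp add: momentum_def)

lemma site_compact_config:
  assumes "1 \<le> N" "N \<le> L - 1" "k < N"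
  shows "site (compact_config L N) k = (if k < N - N div 2 then k else L - N + k)"
proof -
  define p where "p = N div 2"
  have c: "compact_config L N = {0..<N - p} \<union> {L - p..<L}"
  proof (cases "odd N")
    case True
    then have "N - p = Suc p" unfolding p_def by presburger
    then show ?thesis using True
      by (simp add: compact_config_def Let_def p_def[symmetric] atLeastLessThanSuc_atLeastAtMost)
  next
    case False
    then have "N - p = p" unfolding p_def by presburger
    then show ?thesis using False by (simp add: compact_config_def Let_def p_def[symmetric])
  qed
  have "sorted_list_of_set (compact_config L N) = [0..<N - p] @ [L - p..<L]"
    by (rule strict_sorted_equal) (use assms in \<open>auto simp: c sorted_wrt_append p_def\<close>)
  then show ?thesis using assms by (auto simp: site_def nth_append p_def)
qed

text \<open>Modulo \<open>L\<close> the shifted compact configuration is the arithmetic progression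
  \<open>-(N - 1)/2, \<dots>, (N - 1)/2\<close>; this is what \<open>\<gamma>\<close> is for. Its upper block represents the negative
  momenta, hence the reordering \<open>\<tau>\<close>.\<close>

lemma momentum_compact_config:
  assumes "1 \<le> N" "N \<le> L - 1"
  obtains \<tau> b where "\<tau> permutes {0..<N}"
    "\<And>k. k < N \<Longrightarrow> momentum N (compact_config L N) k =
       real (\<tau> k) - (real N - 1) / 2 + real L * of_bool (b k)"
proof -
  define p where "p = N div 2"
  define \<tau> where "\<tau> k = (if k < N - p then k + p else if k < N then k + p - N else k)" for k
  have pN: "p < N" using assms by (simp add: p_def)
  have \<tau>: "\<tau> permutes {0..<N}"
  proof (rule bij_imp_permutes)
    show "bij_betw \<tau> {0..<N} {0..<N}"
      by (rule bij_betw_byWitness[of _ "\<lambda>k. if k < p then k + N - p else k - p"])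
        (use pN in \<open>auto simp: \<tau>_def\<close>)
  qed (use pN in \<open>auto simp: \<tau>_def\<close>)
  have half: "momentum_shift N = real p - (real N - 1) / 2"
  proof (cases "odd N")
    case True
    then have "N = 2 * p + 1" unfolding p_def by presburger
    then show ?thesis using True by (simp add: momentum_shift_def)
  next
    case False
    then have "N = 2 * p" unfolding p_def by presburger
    then show ?thesis using False by (simp add: momentum_shift_def field_simps)
  qed
  have "momentum N (compact_config L N) k =
      real (\<tau> k) - (real N - 1) / 2 + real L * of_bool ((\<lambda>k. \<not> k < N - p) k)" if "k < N" for k
    using site_compact_config[OF assms that] that pN assms
    by (auto simp: momentum_def half \<tau>_def p_def[symmetric] of_nat_diff)
  then show ?thesis by (rule that[OF \<tau>])
qed

lemma slater_compact:
  assumes "1 \<le> N" "N \<le> L - 1"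
  obtains e :: complex where "norm e = 1"
    "\<And>y. slater L N (momentum N (compact_config L N)) y =
      e * (2 ^ (N * (N - 1) div 2) * of_real (sine_product L N y))"
proof -
  let ?c = "compact_config L N"
  define q where "q k = real k - (real N - 1) / 2" for k
  obtain \<tau> b where \<tau>: "\<tau> permutes {0..<N}"
    and mom: "\<And>k. k < N \<Longrightarrow> momentum N ?c k = q (\<tau> k) + real L * of_bool (b k)"
    unfolding q_def by (rule momentum_compact_config[OF assms]) blast
  have wave: "cis (2 * pi * momentum N ?c k * of_int (y j) / real L) =
      cis (2 * pi * q (\<tau> k) * of_int (y j) / real L)" if "k < N" for k j and y :: "nat \<Rightarrow> int"
  proof (cases "b k")
    case True
    then have "2 * pi * momentum N ?c k * of_int (y j) / real L =
        2 * pi * q (\<tau> k) * of_int (y j) / real L + 2 * pi * of_int (y j)"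
      using assms by (simp add: mom[OF that] field_simps)
    moreover have "cis (2 * pi * of_int (y j)) = 1" by (rule cis_multiple_2pi) simp
    ultimately show ?thesis by (simp only: cis_mult[symmetric]) simp
  qed (simp add: mom[OF that])
  have "slater L N (momentum N ?c) y =
      (signof \<tau> * \<i> ^ (N * (N - 1) div 2)) * (2 ^ (N * (N - 1) div 2) * of_real (sine_product L N y))"
    for y
  proof -
    let ?M = "mat N N (\<lambda>(k, j). cis (2 * pi * q k * of_int (y j) / real L))"
    have "slater L N (momentum N ?c) y = det (mat N N (\<lambda>(k, j). ?M $$ (\<tau> k, j)))"
      unfolding slater_def
      by (intro arg_cong[of _ _ det] cong_mat) (auto simp: wave permutes_nat_lt[OF \<tau>])
    also have "\<dots> = signof \<tau> * slater L N q y"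
      using det_permute_rows[of ?M N \<tau>] \<tau> by (simp add: slater_def)
    also have "slater L N q y =
        (2 * \<i>) ^ (N * (N - 1) div 2) * of_real (sine_product L N y)"
      unfolding q_def using slater_centred[of L N y] assms by simp
    finally show ?thesis by (simp add: power_mult_distrib mult_ac)
  qed
  moreover have "norm (signof \<tau> * \<i> ^ (N * (N - 1) div 2) :: complex) = 1"
    by (simp add: norm_mult norm_power sign_def)
  ultimately show ?thesis using that by blast
qed

text \<open>The cosines over a centred arithmetic progression telescope after multiplication by
  \<open>2 sin (\<pi> / L)\<close>.\<close>

lemma rho_compact_config:
  assumes N: "1 \<le> N" "N \<le> L - 1"
  shows "rho L N (compact_config L N) = 2 * sin (real N * pi / real L) / sin (pi / real L)"
proof -
  define \<alpha> where "\<alpha> = pi / real L"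
  have "L > 1" using N by simp
  then have s: "sin \<alpha> > 0" unfolding \<alpha>_def by (intro sin_gt_zero) (auto simp: field_simps)
  obtain \<tau> b where \<tau>: "\<tau> permutes {0..<N}"
    and mom: "\<And>k. k < N \<Longrightarrow> momentum N (compact_config L N) k =
      real (\<tau> k) - (real N - 1) / 2 + real L * of_bool (b k)"
    by (rule momentum_compact_config[OF N]) blast
  define g where "g k = cos (\<alpha> * (2 * real k + 1 - real N))" for k
  have cosines: "cos (2 * pi * momentum N (compact_config L N) k / real L) = g (\<tau> k)" if "k < N" for k
  proof -
    have "2 * pi * momentum N (compact_config L N) k / real L =
        \<alpha> * (2 * real (\<tau> k) + 1 - real N) + 2 * pi * of_bool (b k)"
      using \<open>L > 1\<close> unfolding mom[OF that] \<alpha>_def by (simp add: field_simps)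
    then show ?thesis by (cases "b k") (simp_all add: g_def)
  qed
  have "(\<Sum>k<N. cos (2 * pi * momentum N (compact_config L N) k / real L)) = (\<Sum>k<N. g (\<tau> k))"
    using cosines by simp
  also have "\<dots> = (\<Sum>k<N. g k)"
    using sum.reindex_bij_betw[of \<tau> "{..<N}" "{..<N}" g] permutes_imp_bij[OF \<tau>]
    by (simp add: atLeast0LessThan)
  finally have rho: "rho L N (compact_config L N) = 2 * (\<Sum>k<N. g k)"
    by (simp add: rho_def momentum_def)
  define f where "f k = sin (\<alpha> * (2 * real k - real N))" for k
  have tele: "f (Suc k) - f k = 2 * sin \<alpha> * g k" for k
  proof -
    define x where "x = \<alpha> * (2 * real k + 1 - real N)"
    have "f (Suc k) = sin (x + \<alpha>)" "f k = sin (x - \<alpha>)"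
      by (simp_all add: f_def x_def algebra_simps)
    then show ?thesis by (simp add: g_def x_def[symmetric] sin_add sin_diff)
  qed
  have "2 * sin \<alpha> * (\<Sum>k<N. g k) = f N - f 0"
    unfolding sum_distrib_left tele[symmetric] by (rule sum_lessThan_telescope)
  also have "\<dots> = 2 * sin (real N * \<alpha>)" by (simp add: f_def mult.commute)
  finally have "(\<Sum>k<N. g k) = sin (real N * \<alpha>) / sin \<alpha>" using s by (simp add: field_simps)
  then show ?thesis unfolding rho by (simp add: \<alpha>_def)
qed

text \<open>The common factor \<open>\<kappa>\<close> of \<open>slater_permute_shift\<close> can be read off from the compact configuration:
  it is the ratio of two positive products of sines and has modulus 1, so it is 1.\<close>

lemma slater_eq_sorted:
  assumes N: "1 \<le> N" "N \<le> L - 1"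
    and \<sigma>: "\<sigma> permutes {0..<N}" and y: "\<And>j. j < N \<Longrightarrow> y j = z (\<sigma> j) + int L * n j"
    and pos: "sine_product L N y > 0" "sine_product L N z > 0"
  shows "slater L N (momentum N \<xi>) y = slater L N (momentum N \<xi>) z"
proof -
  define \<kappa> :: complex where
    "\<kappa> = signof \<sigma> * (\<Prod>j<N. cis (2 * pi * momentum_shift N * of_int (n j)))"
  have \<kappa>: "slater L N (momentum N \<zeta>) y = \<kappa> * slater L N (momentum N \<zeta>) z" for \<zeta>
    unfolding \<kappa>_def
  proof (rule slater_permute_shift[OF _ \<sigma>])
    show "y j = z (\<sigma> j) + int L * n j" if "j < N" for j by (rule y[OF that])
    show "momentum N \<zeta> k = of_int (int (site \<zeta> k)) + momentum_shift N" for k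
      by (rule momentum_int)
  qed (use N in auto)
  obtain e where e: "norm e = 1" "\<And>y. slater L N (momentum N (compact_config L N)) y =
      e * (2 ^ (N * (N - 1) div 2) * of_real (sine_product L N y))"
    using slater_compact[OF N] by blast
  have "e \<noteq> 0" using e(1) by auto
  then have s: "of_real (sine_product L N y) = \<kappa> * of_real (sine_product L N z)"
    using \<kappa>[of "compact_config L N"] by (simp add: e(2))
  have "norm \<kappa> = 1"
    by (simp add: \<kappa>_def norm_mult prod_norm[symmetric] sign_def)
  then have "sine_product L N y = sine_product L N z"
    using arg_cong[OF s, of norm] pos by (simp add: norm_mult)
  then have "\<kappa> = 1" using s pos by simp
  then show ?thesis using \<kappa> by simp
qed

lemma sine_product_pos:
  assumes "\<And>i j. i < j \<Longrightarrow> j < N \<Longrightarrow> y i < y j \<and> y j - y i < int L"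
  shows "sine_product L N y > 0"
  unfolding sine_product_def
proof (intro prod_pos ballI)
  fix j i assume h: "j \<in> {..<N}" "i \<in> {..<j}"
  then have *: "0 < y j - y i" "y j - y i < int L" using assms[of i j] by auto
  then have "L > 0" by linarith
  have "of_int (y j - y i) < real L" using *(2) by linarith
  then have "of_int (y j - y i) * pi < real L * pi" by (intro mult_strict_right_mono) auto
  then have "of_int (y j - y i) * pi / real L < pi" using \<open>L > 0\<close> by (simp add: field_simps)
  moreover have "0 < of_int (y j - y i) * pi / real L"
    using * \<open>L > 0\<close> by (intro divide_pos_pos mult_pos_pos) auto
  ultimately show "0 < sin (of_int (y j - y i) * pi / real L)" by (intro sin_gt_zero)
qed

lemma sine_product_site_pos:
  assumes "\<eta> \<in> configs L N"
  shows "sine_product L N (\<lambda>j. int (site \<eta> j)) > 0"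
proof (rule sine_product_pos)
  fix i j assume "i < j" "j < N"
  then show "int (site \<eta> i) < int (site \<eta> j) \<and> int (site \<eta> j) - int (site \<eta> i) < int L"
    using site_strict_mono[OF assms, of i j] site_less[OF assms, of j] by linarith
qed

section \<open>Eigenfunctions of the adjacency matrix\<close>

lemma neighbour_less: "L > 0 \<Longrightarrow> neighbour L x d < L"
  unfolding neighbour_def by (simp add: nat_less_iff)

lemma int_neighbour: "L > 0 \<Longrightarrow> int (neighbour L x d) = (int x + d) mod int L"
  unfolding neighbour_def by simp

text \<open>The pairs of a particle and a direction are grouped by the configuration they lead to. Counting
  moves with multiplicity makes this valid also for the double edge at \<open>L = 2\<close>.\<close>

lemma sum_moves:
  fixes f :: "nat set \<Rightarrow> 'a :: semiring_1"
  assumes "L > 0" "\<eta> \<in> configs L N"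
  shows "(\<Sum>\<zeta>\<in>configs L N. of_nat (card (moves L \<eta> \<zeta>)) * f \<zeta>) =
    (\<Sum>j<N. \<Sum>d\<in>{1, -1}. if neighbour L (site \<eta> j) d \<in> \<eta> then 0
       else f (insert (neighbour L (site \<eta> j) d) (\<eta> - {site \<eta> j})))"
proof -
  have fin: "finite \<eta>" using assms(2) finite_subset[of \<eta> "{..<L}"] by (auto simp: configs_def)
  define M where "M = {m \<in> \<eta> \<times> {1, -1}. neighbour L (fst m) (snd m) \<notin> \<eta>}"
  define g where "g m = insert (neighbour L (fst m) (snd m)) (\<eta> - {fst m})" for m
  have finM: "finite M" using fin by (auto simp: M_def)
  have gM: "g ` M \<subseteq> configs L N"
    using move_in_configs[OF assms(2)] neighbour_less[OF assms(1)] by (auto simp: M_def g_def)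
  have "moves L \<eta> \<zeta> = {m \<in> M. g m = \<zeta>}" for \<zeta>
    by (auto simp: moves_def M_def g_def)
  then have "(\<Sum>\<zeta>\<in>configs L N. of_nat (card (moves L \<eta> \<zeta>)) * f \<zeta>) =
      (\<Sum>\<zeta>\<in>configs L N. \<Sum>m\<in>{m \<in> M. g m = \<zeta>}. f (g m))" by simp
  also have "\<dots> = (\<Sum>m\<in>M. f (g m))"
    by (rule sum.group[OF finM finite_configs gM])
  also have "\<dots> = (\<Sum>m\<in>\<eta> \<times> {1, -1}. if neighbour L (fst m) (snd m) \<in> \<eta> then 0 else f (g m))"
    using fin by (intro sum.mono_neutral_cong_left) (auto simp: M_def)
  also have "\<dots> = (\<Sum>x\<in>\<eta>. \<Sum>d\<in>{1, -1}. if neighbour L x d \<in> \<eta> then 0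
      else f (insert (neighbour L x d) (\<eta> - {x})))"
    by (simp only: sum.cartesian_product) (auto simp: g_def intro!: sum.cong)
  also have "\<dots> = (\<Sum>j\<in>{0..<N}. \<Sum>d\<in>{1, -1}. if neighbour L (site \<eta> j) d \<in> \<eta> then 0
       else f (insert (neighbour L (site \<eta> j) d) (\<eta> - {site \<eta> j})))"
    by (rule sum.reindex_bij_betw[OF bij_betw_site[OF assms(2)], symmetric])
  finally show ?thesis by (simp add: atLeast0LessThan)
qed

text \<open>After an allowed move the differences of later and earlier coordinates stay in \<open>[0, L]\<close> and
  avoid both end points, since no two coordinates agree modulo \<open>L\<close>. All sines are then positive,
  also when the particle has crossed from \<open>L - 1\<close> to \<open>L\<close> or from \<open>0\<close> to \<open>-1\<close>.\<close>

lemma slater_hop: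
  assumes N: "1 \<le> N" "N \<le> L - 1" and \<eta>: "\<eta> \<in> configs L N" and j: "j < N" and d: "d \<in> {1, -1}"
  defines "x \<equiv> site \<eta> j" and "y \<equiv> (\<lambda>i. int (site \<eta> i))"
  shows "slater L N (momentum N \<xi>) (y(j := y j + d)) =
    (if neighbour L x d \<in> \<eta> then 0
     else slater L N (momentum N \<xi>) (\<lambda>i. int (site (insert (neighbour L x d) (\<eta> - {x})) i)))"
proof -
  let ?nb = "neighbour L x d" and ?y = "y(j := y j + d)"
  have L: "L > 0" "L \<ge> 2" using N by auto
  note bij = bij_betw_site[OF \<eta>]
  have x: "x \<in> \<eta>" "x < L"
    using bij_betwE[OF bij] j site_less[OF \<eta> j] by (auto simp: x_def)
  have nb: "int ?nb + int L * ((int x + d) div int L) = int x + d"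
    using L by (simp add: int_neighbour)
  show ?thesis
  proof (cases "?nb \<in> \<eta>")
    case True
    then have "?nb \<in> site \<eta> ` {0..<N}" using bij by (simp add: bij_betw_def)
    then obtain i where i: "i < N" "site \<eta> i = ?nb" by auto
    have "?nb \<noteq> x"
    proof
      assume "?nb = x"
      then have "int L dvd d" using nb by (metis add_left_cancel dvd_triv_left)
      then show False using d L zdvd_imp_le[of "int L" 1] by auto
    qed
    then have "i \<noteq> j" using i by (auto simp: x_def)
    then have "slater L N (momentum N \<xi>) ?y = 0"
      by (intro slater_collision[OF L(1) i(1) j _ _ momentum_int, of _ "(int x + d) div int L"])
        (use nb i in \<open>auto simp: y_def x_def\<close>)
    then show ?thesis using True by simp
  next
    case False
    define \<zeta> where "\<zeta> = insert ?nb (\<eta> - {x})"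
    have \<zeta>: "\<zeta> \<in> configs L N"
      unfolding \<zeta>_def using \<eta> x(1) neighbour_less[OF L(1)] False by (rule move_in_configs)
    define w where "w = (site \<eta>)(j := ?nb)"
    have inj_w: "inj_on w {0..<N}"
      unfolding w_def by (rule inj_on_fun_updI) (use bij False in \<open>auto simp: bij_betw_def\<close>)
    have "w ` {0..<N} = insert ?nb (site \<eta> ` ({0..<N} - {j}))"
      using j by (auto simp: w_def image_iff)
    also have "site \<eta> ` ({0..<N} - {j}) = \<eta> - {x}"
      using inj_on_image_set_diff[of "site \<eta>" "{0..<N}" "{0..<N}" "{j}"] bij j
      by (simp add: bij_betw_def x_def)
    finally have "w ` {0..<N} = \<zeta>" by (simp add: \<zeta>_def)
    from configs_sort_permutation[OF inj_w this \<zeta>] obtain \<sigma> where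
      \<sigma>: "\<sigma> permutes {0..<N}" "\<And>i. i < N \<Longrightarrow> w i = site \<zeta> (\<sigma> i)" by blast
    \<comment> \<open>winding numbers: nonzero only if the particle \<open>j\<close> crosses the bond between \<open>L - 1\<close> and \<open>0\<close>\<close>
    define n where "n i = (if i = j then (int x + d) div int L else 0)" for i
    have yw: "?y i = int (w i) + int L * n i" for i
      using nb by (auto simp: w_def n_def y_def x_def)
    have apart: "?y i \<noteq> ?y k + int L * m" if "i < N" "k < N" "i \<noteq> k" for i k m
    proof
      assume "?y i = ?y k + int L * m"
      then have "int (w i) - int (w k) = int L * (m + n k - n i)"
        by (simp only: yw) (simp add: algebra_simps)
      then have dvd: "int L dvd int (w i) - int (w k)" by (simp only: dvd_triv_left)
      have "w l < L" if "l < N" for l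
        using site_less[OF \<eta> that] neighbour_less[OF L(1)] by (simp add: w_def)
      from this[of i] this[of k] have "\<bar>int (w i) - int (w k)\<bar> < int L" using that(1,2) by linarith
      then have "int (w i) - int (w k) = 0"
        using dvd_imp_le_int[OF _ dvd] by linarith
      then have "w i = w k" by simp
      then show False using inj_onD[OF inj_w, of i k] that by simp
    qed
    have "slater L N (momentum N \<xi>) ?y = slater L N (momentum N \<xi>) (\<lambda>i. int (site \<zeta> i))"
    proof (rule slater_eq_sorted[OF N \<sigma>(1)])
      show "?y i = int (site \<zeta> (\<sigma> i)) + int L * n i" if "i < N" for i
        using yw[of i] \<sigma>(2)[OF that] by simp
      show "sine_product L N (\<lambda>i. int (site \<zeta> i)) > 0" by (rule sine_product_site_pos[OF \<zeta>])
      show "sine_product L N ?y > 0"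
      proof (rule sine_product_pos)
        fix i k assume ik: "i < k" "k < N"
        have "y i < y k" "y k - y i < int L"
          using site_strict_mono[OF \<eta> ik] site_less[OF \<eta> ik(2)] by (auto simp: y_def)
        moreover have "?y k \<noteq> ?y i" "?y k \<noteq> ?y i + int L"
          using apart[of k i 0] apart[of k i 1] ik by auto
        ultimately show "?y i < ?y k \<and> ?y k - ?y i < int L"
          using d ik by (auto split: if_splits)
      qed
    qed
    then show ?thesis using False by (simp add: \<zeta>_def)
  qed
qed

lemma psi_on_slater:
  "psi_on L N \<xi> \<eta> =
     slater L N (momentum N \<xi>) (\<lambda>i. int (site \<eta> i)) / of_real (real L powr (real N / 2))"
proof -
  have "exp (2 * \<i> * complex_of_real pi * complex_of_real (real (site \<xi> k) + momentum_shift N)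
            * complex_of_real (real (site \<eta> j)) / of_nat L) =
      cis (2 * pi * momentum N \<xi> k * of_int (int (site \<eta> j)) / real L)" for k j
    by (simp add: cis_conv_exp momentum_def mult_ac)
  then show ?thesis by (simp add: psi_on_def psi_def slater_def)
qed

lemma psi_on_eigenfunction:
  assumes N: "1 \<le> N" "N \<le> L - 1" and \<eta>: "\<eta> \<in> configs L N"
  shows "(\<Sum>\<zeta>\<in>configs L N. of_nat (card (moves L \<eta> \<zeta>)) * psi_on L N \<xi> \<zeta>) =
    of_real (rho L N \<xi>) * psi_on L N \<xi> \<eta>"
proof -
  let ?s = "slater L N (momentum N \<xi>)"
  define y where "y i = int (site \<eta> i)" for i
  define c :: complex where "c = of_real (real L powr (real N / 2))"
  have hop1: "(if neighbour L (site \<eta> j) d \<in> \<eta> then 0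
       else psi_on L N \<xi> (insert (neighbour L (site \<eta> j) d) (\<eta> - {site \<eta> j}))) =
     ?s (y(j := y j + d)) / c" if "j < N" "d \<in> {1, -1}" for j d
    using slater_hop[OF N \<eta> that, of \<xi>] by (simp add: psi_on_slater y_def[abs_def] c_def)
  have "(\<Sum>\<zeta>\<in>configs L N. of_nat (card (moves L \<eta> \<zeta>)) * psi_on L N \<xi> \<zeta>) =
      (\<Sum>j<N. \<Sum>d\<in>{1, -1}. ?s (y(j := y j + d)) / c)"
  proof -
    have "L > 0" using N by simp
    show ?thesis unfolding sum_moves[OF \<open>L > 0\<close> \<eta>]
    proof (rule sum.cong[OF refl], rule sum.cong[OF refl])
      fix j d assume "j \<in> {..<N}" "d \<in> {1, -1 :: int}"
      then show "(if neighbour L (site \<eta> j) d \<in> \<eta> then 0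
          else psi_on L N \<xi> (insert (neighbour L (site \<eta> j) d) (\<eta> - {site \<eta> j}))) =
        ?s (y(j := y j + d)) / c" using hop1 by blast
    qed
  qed
  also have "\<dots> = (\<Sum>j<N. ?s (y(j := y j + 1)) + ?s (y(j := y j - 1))) / c"
    by (simp add: sum_divide_distrib add_divide_distrib)
  also have "\<dots> = of_real (rho L N \<xi>) * (?s y / c)"
    unfolding slater_hop_sum by (simp add: rho_def momentum_def)
  also have "?s y / c = psi_on L N \<xi> \<eta>" by (simp add: psi_on_slater y_def[abs_def] c_def)
  finally show ?thesis .
qed

section \<open>Orthonormality\<close>

lemma sum_roots_of_unity:
  assumes "\<bar>d\<bar> < int L"
  shows "(\<Sum>m<L. cis (2 * pi * of_int d * real m / real L)) = (if d = 0 then of_nat L else 0)"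
proof (cases "d = 0")
  case False
  define z where "z = cis (2 * pi * of_int d / real L)"
  have L: "L > 0" using assms by linarith
  have "z \<noteq> 1"
  proof
    assume "z = 1"
    then have "cos (2 * pi * of_int d / real L) = 1" by (simp add: z_def complex_eq_iff)
    then obtain n :: int where "2 * pi * of_int d / real L = of_int n * 2 * pi"
      by (auto simp: cos_one_2pi_int)
    then have "real_of_int d = of_int n * real L" using L by (simp add: field_simps)
    then have "d = n * int L" by (metis of_int_eq_iff of_int_mult of_int_of_nat_eq)
    then have "int L dvd d" by simp
    then show False using dvd_imp_le_int[OF False, of "int L"] assms by simp
  qed
  moreover have "z ^ L = 1"
  proof -
    have "z ^ L = cis (2 * pi * of_int d)" using L by (simp add: z_def DeMoivre)
    then show ?thesis using cis_multiple_2pi[of "of_int d"] by simp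
  qed
  moreover have "cis (2 * pi * of_int d * real m / real L) = z ^ m" for m
    by (simp add: z_def DeMoivre mult_ac)
  ultimately show ?thesis using False by (simp add: sum_gp_strict)
qed simp

text \<open>By Cauchy-Binet the inner product is a determinant whose entries are \<open>L\<close> at equal momenta and
  \<open>0\<close> elsewhere. For \<open>\<xi> \<noteq> \<xi>'\<close> some site of \<open>\<xi>\<close> is missing in \<open>\<xi>'\<close> and gives a zero row.\<close>

lemma psi_on_orthonormal:
  assumes L: "L > 0" and \<xi>: "\<xi> \<in> configs L N" and \<xi>': "\<xi>' \<in> configs L N"
  shows "(\<Sum>\<eta>\<in>configs L N. psi_on L N \<xi> \<eta> * cnj (psi_on L N \<xi>' \<eta>)) = (if \<xi> = \<xi>' then 1 else 0)"
proof -
  let ?A = "\<lambda>k m. cis (2 * pi * momentum N \<xi> k * real m / real L)"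
  let ?B = "\<lambda>m l. cis (2 * pi * - momentum N \<xi>' l * real m / real L)"
  let ?G = "mat N N (\<lambda>(k, l). if site \<xi> k = site \<xi>' l then of_nat L else 0 :: complex)"
  have gram: "(\<Sum>m<L. ?A k m * ?B m l) = (if site \<xi> k = site \<xi>' l then of_nat L else 0)"
    if "k < N" "l < N" for k l
  proof -
    define d where "d = int (site \<xi> k) - int (site \<xi>' l)"
    have "\<bar>d\<bar> < int L" using site_less[OF \<xi> that(1)] site_less[OF \<xi>' that(2)] by (simp add: d_def)
    moreover have "?A k m * ?B m l = cis (2 * pi * of_int d * real m / real L)" for m
      unfolding cis_mult by (intro arg_cong[of _ _ cis])
        (simp add: d_def momentum_def add_divide_distrib[symmetric] algebra_simps)
    ultimately show ?thesis using sum_roots_of_unity[of d L] by (simp add: d_def)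
  qed
  have "(\<Sum>\<eta>\<in>configs L N. slater L N (momentum N \<xi>) (\<lambda>i. int (site \<eta> i)) *
      cnj (slater L N (momentum N \<xi>') (\<lambda>i. int (site \<eta> i)))) =
      (\<Sum>\<eta>\<in>configs L N. det (mat N N (\<lambda>(k, j). ?A k (site \<eta> j))) *
        det (mat N N (\<lambda>(j, l). ?B (site \<eta> j) l)))"
  proof (intro sum.cong arg_cong2[of _ _ _ _ "(*)"] refl)
    fix \<eta>
    show "slater L N (momentum N \<xi>) (\<lambda>i. int (site \<eta> i)) = det (mat N N (\<lambda>(k, j). ?A k (site \<eta> j)))"
      by (simp add: slater_def)
    have "mat N N (\<lambda>(j, l). ?B (site \<eta> j) l) =
        transpose_mat (mat N N (\<lambda>(l, j). ?B (site \<eta> j) l))"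
      by (intro eq_matI) auto
    then show "cnj (slater L N (momentum N \<xi>') (\<lambda>i. int (site \<eta> i))) =
        det (mat N N (\<lambda>(j, l). ?B (site \<eta> j) l))"
      using det_transpose[of "mat N N (\<lambda>(l, j). ?B (site \<eta> j) l)" N]
      by (simp only: cnj_slater) (simp add: slater_def)
  qed
  also have "\<dots> = det (mat N N (\<lambda>(k, l). \<Sum>m<L. ?A k m * ?B m l))"
    by (rule cauchy_binet[symmetric])
  also have "\<dots> = det ?G"
    by (intro arg_cong[of _ _ det] cong_mat refl) (simp only: prod.case gram)
  also have "\<dots> = (if \<xi> = \<xi>' then of_nat L ^ N else 0)"
  proof (cases "\<xi> = \<xi>'")
    case True
    have "site \<xi> k = site \<xi> l \<longleftrightarrow> k = l" if "k < N" "l < N" for k l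
      using bij_betw_site[OF \<xi>] that inj_onD[of "site \<xi>" "{0..<N}" k l]
      by (auto simp: bij_betw_def)
    then have "?G = of_nat L \<cdot>\<^sub>m 1\<^sub>m N"
      using True by (intro eq_matI) simp_all
    then show ?thesis using True by simp
  next
    case False
    have "\<not> \<xi> \<subseteq> \<xi>'"
      using False \<xi> \<xi>' card_subset_eq[of \<xi>' \<xi>] finite_subset[of \<xi>' "{..<L}"]
      by (auto simp: configs_def)
    moreover have "\<xi> = site \<xi> ` {0..<N}" using bij_betw_site[OF \<xi>] by (simp add: bij_betw_def)
    ultimately obtain k where k: "k < N" "site \<xi> k \<notin> \<xi>'" by (metis atLeastLessThan_iff image_subsetI)
    have zero: "(\<Prod>i=0..<N. ?G $$ (i, p i)) = 0" if "p permutes {0..<N}" for p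
    proof (rule prod_zero)
      have "?G $$ (k, p k) = 0"
        using k permutes_nat_lt[OF that k(1)] bij_betwE[OF bij_betw_site[OF \<xi>']] by auto
      then show "\<exists>i\<in>{0..<N}. ?G $$ (i, p i) = 0" using k(1) by auto
    qed simp
    have "det ?G = (\<Sum>p | p permutes {0..<N}. signof p * (\<Prod>i=0..<N. ?G $$ (i, p i)))"
      by (rule det_def') simp
    also have "\<dots> = 0" by (rule sum.neutral) (simp add: zero del: index_mat)
    finally show ?thesis using False by simp
  qed
  finally have main: "(\<Sum>\<eta>\<in>configs L N. slater L N (momentum N \<xi>) (\<lambda>i. int (site \<eta> i)) *
      cnj (slater L N (momentum N \<xi>') (\<lambda>i. int (site \<eta> i)))) = (if \<xi> = \<xi>' then of_nat L ^ N else 0)" .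
  have "(real L powr (real N / 2)) * (real L powr (real N / 2)) = real L ^ N"
    using L by (simp add: powr_add[symmetric] powr_realpow)
  then have sq: "of_real (real L powr (real N / 2)) * of_real (real L powr (real N / 2)) =
      (of_nat L ^ N :: complex)"
    by (metis of_real_mult of_real_of_nat_eq of_real_power)
  have "(\<Sum>\<eta>\<in>configs L N. psi_on L N \<xi> \<eta> * cnj (psi_on L N \<xi>' \<eta>)) =
      (if \<xi> = \<xi>' then of_nat L ^ N else 0) / (of_nat L ^ N)"
    unfolding main[symmetric] by (simp add: psi_on_slater sum_divide_distrib sq)
  then show ?thesis using L by simp
qed

text \<open>The matrix \<open>P\<close> with columns \<open>u i\<close> is unitary and conjugates \<open>A\<close> to the diagonal matrix of
  the \<open>r i\<close>.\<close>

lemma orthonormal_eigenvectors_spectrum: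
  fixes A :: "complex mat"
  assumes A: "A \<in> carrier_mat n n"
    and u: "\<And>i. i < n \<Longrightarrow> eigenvector A (u i) (r i)"
    and orth: "\<And>i j. i < n \<Longrightarrow> j < n \<Longrightarrow> u i \<bullet>c u j = (if i = j then 1 else 0)"
  shows "orthonormal_basis n (u ` {..<n})" and "spectrum A = r ` {..<n}"
proof -
  have uc: "u i \<in> carrier_vec n" "dim_vec (u i) = n" if "i < n" for i
    using u[OF that] A by (auto simp: eigenvector_def)
  define P where "P = mat n n (\<lambda>(i, j). u j $ i)"
  define Q where "Q = mat n n (\<lambda>(i, j). cnj (u i $ j))"
  define D where "D = mat n n (\<lambda>(i, j). if i = j then r i else 0)"
  have c: "P \<in> carrier_mat n n" "Q \<in> carrier_mat n n" "D \<in> carrier_mat n n"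
    by (auto simp: P_def Q_def D_def)
  have QP: "Q * P = 1\<^sub>m n"
  proof (rule eq_matI)
    fix i j assume ij: "i < dim_row (1\<^sub>m n :: complex mat)" "j < dim_col (1\<^sub>m n :: complex mat)"
    then have "(Q * P) $$ (i, j) = u j \<bullet>c u i"
      using uc[of i] uc[of j] by (auto simp: P_def Q_def scalar_prod_def conjugate_vec_def mult.commute intro!: sum.cong)
    then show "(Q * P) $$ (i, j) = 1\<^sub>m n $$ (i, j)" using ij orth[of j i] by auto
  qed (auto simp: P_def Q_def)
  then have PQ: "P * Q = 1\<^sub>m n" by (rule mat_mult_left_right_inverse[OF c(2,1)])
  have AP: "A * P = P * D"
  proof (rule eq_matI)
    fix i j assume "i < dim_row (P * D)" "j < dim_col (P * D)"
    then have ij: "i < n" "j < n" by (auto simp: P_def D_def)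
    have "col P j = u j" using uc[OF ij(2)] ij by (intro eq_vecI) (auto simp: P_def)
    then have "(A * P) $$ (i, j) = (A *\<^sub>v u j) $ i" using ij A c by auto
    also have "\<dots> = r j * u j $ i"
      using u[OF ij(2)] uc[OF ij(2)] ij by (auto simp: eigenvector_def)
    also have "\<dots> = (\<Sum>k<n. if k = j then u k $ i * r k else 0)" using ij by (simp add: mult.commute)
    also have "\<dots> = (\<Sum>k<n. u k $ i * (if k = j then r k else 0))" by (rule sum.cong) simp_all
    also have "\<dots> = (P * D) $$ (i, j)"
      using ij by (simp add: P_def D_def scalar_prod_def atLeast0LessThan del: sum.delta sum.delta')
    finally show "(A * P) $$ (i, j) = (P * D) $$ (i, j)" .
  qed (use A in \<open>auto simp: P_def D_def\<close>)
  have "A = A * (P * Q)" using A PQ by simp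
  also have "\<dots> = P * D * Q" by (simp only: assoc_mult_mat[OF A c(1,2), symmetric] AP)
  finally have "similar_mat A D"
    by (intro similar_matI[of _ _ P Q n]) (use A c PQ QP in auto)
  then have "char_poly A = char_poly D" by (rule char_poly_similar)
  also have "\<dots> = (\<Prod>a\<leftarrow>diag_mat D. [:- a, 1:])"
    by (rule char_poly_upper_triangular[OF c(3)]) (auto simp: D_def)
  also have "diag_mat D = map r [0..<n]" by (auto simp: diag_mat_def D_def)
  finally show "spectrum A = r ` {..<n}"
    unfolding spectrum_root_char_poly[OF A] by (auto simp: poly_prod_list prod_list_zero_iff)
  interpret vec_space "TYPE(complex)" n .
  have "det Q * det P = 1" using det_mult[OF c(2,1)] QP by simp
  then have "det (transpose_mat P) \<noteq> 0" using det_transpose[OF c(1)] by auto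
  then have li: "lin_indpt (set (rows (transpose_mat P)))"
    by (intro det_not_0_imp_lin_indpt_rows) (use c in auto)
  have "row (transpose_mat P) i = u i" if "i < n" for i
    by (rule eq_vecI) (use uc[OF that] that in \<open>auto simp: P_def\<close>)
  moreover have "dim_row (transpose_mat P) = n" using c by simp
  ultimately have "rows (transpose_mat P) = map u [0..<n]" by (simp add: rows_def)
  then have rows: "set (rows (transpose_mat P)) = u ` {..<n}" by auto
  have inj: "inj_on u {..<n}"
    using orth by (intro inj_onI) (metis lessThan_iff zero_neq_one)
  have "basis (u ` {..<n})"
    by (rule dim_li_is_basis) (use li rows uc in \<open>auto simp: dim_is_n card_image[OF inj]\<close>)
  then show "orthonormal_basis n (u ` {..<n})"
    using orth inj by (auto simp: orthonormal_basis_def inj_on_def)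
qed

lemma adjacency_mat_mult_config_vec:
  "adjacency_mat L N *\<^sub>v config_vec L N f =
     config_vec L N (\<lambda>\<eta>. \<Sum>\<zeta>\<in>configs L N. of_nat (card (moves L \<eta> \<zeta>)) * f \<zeta>)"
proof (rule eq_vecI)
  let ?cs = "config_list L N"
  fix i assume "i < dim_vec (config_vec L N
    (\<lambda>\<eta>. \<Sum>\<zeta>\<in>configs L N. of_nat (card (moves L \<eta> \<zeta>)) * f \<zeta>))"
  then have i: "i < length ?cs" by (simp add: config_vec_def Let_def)
  have "bij_betw ((!) ?cs) {0..<length ?cs} (configs L N)"
    by (rule bij_betw_nth) (auto simp: distinct_config_list set_config_list)
  from sum.reindex_bij_betw[OF this, of "\<lambda>\<zeta>. of_nat (card (moves L (?cs ! i) \<zeta>)) * f \<zeta>"]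
  show "(adjacency_mat L N *\<^sub>v config_vec L N f) $ i = config_vec L N
    (\<lambda>\<eta>. \<Sum>\<zeta>\<in>configs L N. of_nat (card (moves L \<eta> \<zeta>)) * f \<zeta>) $ i"
    using i by (simp add: adjacency_mat_def config_vec_def Let_def scalar_prod_def)
qed (simp add: adjacency_mat_def config_vec_def Let_def)

lemma config_vec_inner:
  "config_vec L N f \<bullet>c config_vec L N g = (\<Sum>\<eta>\<in>configs L N. f \<eta> * cnj (g \<eta>))"
proof -
  let ?cs = "config_list L N"
  have "bij_betw ((!) ?cs) {0..<length ?cs} (configs L N)"
    by (rule bij_betw_nth) (auto simp: distinct_config_list set_config_list)
  from sum.reindex_bij_betw[OF this, of "\<lambda>\<eta>. f \<eta> * cnj (g \<eta>)"]
  show ?thesis by (simp add: config_vec_def Let_def scalar_prod_def conjugate_vec_def)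
qed

lemma config_vec_eq_iff:
  "config_vec L N f = config_vec L N g \<longleftrightarrow> (\<forall>\<eta>\<in>configs L N. f \<eta> = g \<eta>)"
  by (auto simp: config_vec_def Let_def vec_eq_iff set_config_list[symmetric] all_set_conv_all_nth)

lemma eigenvector_config_vec_iff:
  "eigenvector (adjacency_mat L N) (config_vec L N f) c \<longleftrightarrow>
     (\<exists>\<eta>\<in>configs L N. f \<eta> \<noteq> 0) \<and>
     (\<forall>\<eta>\<in>configs L N. (\<Sum>\<zeta>\<in>configs L N. of_nat (card (moves L \<eta> \<zeta>)) * f \<zeta>) = c * f \<eta>)"
proof -
  have "0\<^sub>v (dim_row (adjacency_mat L N)) = config_vec L N (\<lambda>_. 0)"
    by (auto simp: adjacency_mat_def config_vec_def Let_def)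
  moreover have "c \<cdot>\<^sub>v config_vec L N f = config_vec L N (\<lambda>\<eta>. c * f \<eta>)"
    by (auto simp: config_vec_def Let_def)
  moreover have "config_vec L N f \<in> carrier_vec (dim_row (adjacency_mat L N))"
    by (auto simp: adjacency_mat_def config_vec_def Let_def)
  ultimately show ?thesis
    unfolding eigenvector_def adjacency_mat_mult_config_vec by (simp only: config_vec_eq_iff) auto
qed

lemma eigenvector_psi_on:
  assumes N: "1 \<le> N" "N \<le> L - 1" and \<xi>: "\<xi> \<in> configs L N"
  shows "eigenvector (adjacency_mat L N) (config_vec L N (psi_on L N \<xi>)) (of_real (rho L N \<xi>))"
proof -
  have "\<exists>\<eta>\<in>configs L N. psi_on L N \<xi> \<eta> \<noteq> 0"
  proof (rule ccontr)
    assume "\<not> ?thesis"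
    moreover have "L > 0" using N by simp
    ultimately show False using psi_on_orthonormal[of L \<xi> N \<xi>] \<xi> by simp
  qed
  then show ?thesis
    unfolding eigenvector_config_vec_iff using psi_on_eigenfunction[OF N] by blast
qed

lemma psi_on_eigenbasis:
  assumes N: "1 \<le> N" "N \<le> L - 1"
  shows "bij_betw (\<lambda>\<xi>. config_vec L N (psi_on L N \<xi>)) (configs L N)
      ((\<lambda>\<xi>. config_vec L N (psi_on L N \<xi>)) ` configs L N)" (is "bij_betw ?F _ _")
    and "orthonormal_basis (length (config_list L N))
      ((\<lambda>\<xi>. config_vec L N (psi_on L N \<xi>)) ` configs L N)"
    and "spectrum (adjacency_mat L N) = {complex_of_real (rho L N \<xi>) | \<xi>. \<xi> \<in> configs L N}"
proof -
  let ?cs = "config_list L N"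
  have orth: "?F \<xi> \<bullet>c ?F \<xi>' = (if \<xi> = \<xi>' then 1 else 0)"
    if "\<xi> \<in> configs L N" "\<xi>' \<in> configs L N" for \<xi> \<xi>'
    unfolding config_vec_inner using psi_on_orthonormal[OF _ that] N by simp
  then have "inj_on ?F (configs L N)" by (intro inj_onI) (metis zero_neq_one)
  then show "bij_betw ?F (configs L N) (?F ` configs L N)" by (rule inj_on_imp_bij_betw)
  have mem: "?cs ! i \<in> configs L N" if "i < length ?cs" for i
    using nth_mem[OF that] by (simp add: set_config_list)
  have img: "(\<lambda>i. ?cs ! i) ` {..<length ?cs} = configs L N"
    by (auto simp: set_config_list[symmetric] set_conv_nth)
  have A: "adjacency_mat L N \<in> carrier_mat (length ?cs) (length ?cs)"
    by (simp add: adjacency_mat_def Let_def)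
  have "?F (?cs ! i) \<bullet>c ?F (?cs ! j) = (if i = j then 1 else 0)"
    if "i < length ?cs" "j < length ?cs" for i j
    using orth[OF mem mem] that nth_eq_iff_index_eq[OF distinct_config_list that] by simp
  note spec = orthonormal_eigenvectors_spectrum[OF A, of "\<lambda>i. ?F (?cs ! i)"
      "\<lambda>i. complex_of_real (rho L N (?cs ! i))", OF eigenvector_psi_on[OF N mem] this]
  have "(\<lambda>i. ?F (?cs ! i)) ` {..<length ?cs} = ?F ` configs L N"
    by (simp only: img[symmetric] image_image)
  then show "orthonormal_basis (length ?cs) (?F ` configs L N)" using spec(1) by simp
  have "(\<lambda>i. complex_of_real (rho L N (?cs ! i))) ` {..<length ?cs} =
      (\<lambda>\<xi>. complex_of_real (rho L N \<xi>)) ` configs L N"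
    by (simp only: img[symmetric] image_image)
  then show "spectrum (adjacency_mat L N) = {complex_of_real (rho L N \<xi>) | \<xi>. \<xi> \<in> configs L N}"
    using spec(2) by auto
qed

section \<open>The Perron-Frobenius eigenfunction\<close>

text \<open>At a point where \<open>|w| / v\<close> attains its maximum \<open>M\<close>, the eigenvalue equations give
  \<open>|c| |w| \<le> \<Sum> a |w| \<le> M \<Sum> a v = r M v = r |w|\<close>.\<close>

lemma eigenvalue_norm_le_positive_eigenvalue:
  fixes a :: "'i \<Rightarrow> 'i \<Rightarrow> real" and w :: "'i \<Rightarrow> complex"
  assumes S: "finite S" and a: "\<And>x y. x \<in> S \<Longrightarrow> y \<in> S \<Longrightarrow> 0 \<le> a x y"
    and v: "\<And>x. x \<in> S \<Longrightarrow> 0 < v x" "\<And>x. x \<in> S \<Longrightarrow> (\<Sum>y\<in>S. a x y * v y) = r * v x"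
    and w: "\<And>x. x \<in> S \<Longrightarrow> (\<Sum>y\<in>S. of_real (a x y) * w y) = c * w x"
    and nz: "z \<in> S" "w z \<noteq> 0"
  shows "norm c \<le> r"
proof -
  define q where "q x = norm (w x) / v x" for x
  have "Max (q ` S) \<in> q ` S" using S nz by (intro Max_in) auto
  then obtain x where x: "x \<in> S" "q x = Max (q ` S)" by auto
  have le: "norm (w y) \<le> q x * v y" if "y \<in> S" for y
  proof -
    have "q y \<le> q x" using S that by (simp add: x(2))
    then show ?thesis using v(1)[OF that] by (simp add: q_def[of y] pos_divide_le_eq)
  qed
  have "0 < norm (w z)" using nz by simp
  then have "0 < q x * v z" using le[OF nz(1)] by linarith
  then have "0 < q x" using v(1)[OF nz(1)] by (simp add: zero_less_mult_iff)
  then have wx: "0 < norm (w x)" "norm (w x) = q x * v x"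
    using v(1)[OF x(1)] by (auto simp: q_def)
  have "norm c * norm (w x) = norm (\<Sum>y\<in>S. of_real (a x y) * w y)"
    by (simp add: w[OF x(1)] norm_mult)
  also have "\<dots> \<le> (\<Sum>y\<in>S. a x y * (q x * v y))"
    by (rule sum_norm_le) (use a x(1) le in \<open>auto simp: norm_mult intro!: mult_left_mono\<close>)
  also have "\<dots> = q x * (\<Sum>y\<in>S. a x y * v y)" by (simp add: sum_distrib_left mult_ac)
  also have "\<dots> = r * norm (w x)" by (simp add: v(2)[OF x(1)] wx(2))
  finally show ?thesis using wx(1) by simp
qed

text \<open>Let \<open>t\<close> be the minimum of \<open>w / v\<close>. Then \<open>w - t v\<close> is a nonnegative eigenfunction with a zero, and
  its zero set is closed under passing to neighbours. The hypothesis \<open>conn\<close> is irreducibility of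
  \<open>a\<close>.\<close>

lemma positive_eigenfunction_unique:
  fixes a :: "'i \<Rightarrow> 'i \<Rightarrow> real"
  assumes S: "finite S" "S \<noteq> {}" and a: "\<And>x y. x \<in> S \<Longrightarrow> y \<in> S \<Longrightarrow> 0 \<le> a x y"
    and conn: "\<And>Z. Z \<subseteq> S \<Longrightarrow> Z \<noteq> {} \<Longrightarrow> (\<And>x y. x \<in> Z \<Longrightarrow> y \<in> S \<Longrightarrow> 0 < a x y \<Longrightarrow> y \<in> Z) \<Longrightarrow> Z = S"
    and v: "\<And>x. x \<in> S \<Longrightarrow> 0 < v x" "\<And>x. x \<in> S \<Longrightarrow> (\<Sum>y\<in>S. a x y * v y) = r * v x"
    and w: "\<And>x. x \<in> S \<Longrightarrow> 0 < w x" "\<And>x. x \<in> S \<Longrightarrow> (\<Sum>y\<in>S. a x y * w y) = r * w x"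
  obtains t where "0 < t" "\<And>x. x \<in> S \<Longrightarrow> w x = t * v x"
proof -
  define q where "q x = w x / v x" for x
  have "Min (q ` S) \<in> q ` S" using S by (intro Min_in) auto
  then obtain x0 where x0: "x0 \<in> S" "q x0 = Min (q ` S)" by auto
  define t where "t = q x0"
  define z where "z x = w x - t * v x" for x
  have z0: "0 \<le> z y" if "y \<in> S" for y
  proof -
    have "t \<le> q y" using S that by (simp add: t_def x0(2))
    then show ?thesis using v(1)[OF that] by (simp add: z_def q_def pos_le_divide_eq)
  qed
  have az: "(\<Sum>y\<in>S. a x y * z y) = r * z x" if "x \<in> S" for x
  proof -
    have "(\<Sum>y\<in>S. a x y * z y) = (\<Sum>y\<in>S. a x y * w y) - t * (\<Sum>y\<in>S. a x y * v y)"
      by (simp add: z_def right_diff_distrib sum_subtractf sum_distrib_left mult_ac)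
    then show ?thesis using v(2)[OF that] w(2)[OF that] by (simp add: z_def algebra_simps)
  qed
  have "{x \<in> S. z x = 0} = S"
  proof (rule conn)
    show "{x \<in> S. z x = 0} \<noteq> {}"
      using x0(1) v(1)[OF x0(1)] by (auto simp: z_def t_def q_def intro!: exI[of _ x0])
  next
    fix x y assume h: "x \<in> {x \<in> S. z x = 0}" "y \<in> S" "0 < a x y"
    then have "(\<Sum>y\<in>S. a x y * z y) = 0" using az[of x] by simp
    then have "\<forall>y\<in>S. a x y * z y = 0"
      using S h a z0 by (subst (asm) sum_nonneg_eq_0_iff) auto
    then show "y \<in> {x \<in> S. z x = 0}" using h by auto
  qed auto
  then have "\<And>x. x \<in> S \<Longrightarrow> w x = t * v x" by (auto simp: z_def)
  moreover have "0 < t" using v(1) w(1) x0(1) by (simp add: t_def q_def)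
  ultimately show ?thesis using that by blast
qed

text \<open>If no particle can step down, the configuration is an initial segment.\<close>

lemma exists_left_move:
  assumes \<eta>: "\<eta> \<in> configs L N" and ne: "\<eta> \<noteq> {..<N}"
  obtains \<zeta> where "\<zeta> \<in> configs L N" "moves L \<eta> \<zeta> \<noteq> {}" "moves L \<zeta> \<eta> \<noteq> {}" "\<Sum>\<zeta> < \<Sum>\<eta>"
proof -
  have fin: "finite \<eta>" and card: "card \<eta> = N" and sub: "\<eta> \<subseteq> {..<L}"
    using \<eta> finite_subset[of \<eta> "{..<L}"] by (auto simp: configs_def)
  have "\<exists>x. Suc x \<in> \<eta> \<and> x \<notin> \<eta>"
  proof (rule ccontr)
    assume "\<not> ?thesis"
    then have down: "Suc x \<in> \<eta> \<Longrightarrow> x \<in> \<eta>" for x by blast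
    have "{..x} \<subseteq> \<eta>" if "x \<in> \<eta>" for x
      using that by (induction x) (auto simp: atMost_Suc dest: down)
    then have "Suc x \<le> N" if "x \<in> \<eta>" for x
      using card_mono[OF fin, of "{..x}"] that card by simp
    then have "\<eta> \<subseteq> {..<N}" by (auto simp: Suc_le_eq)
    then show False using ne card card_subset_eq[of "{..<N}" \<eta>] by simp
  qed
  then obtain x where x: "Suc x \<in> \<eta>" "x \<notin> \<eta>" by blast
  then have xL: "Suc x < L" using sub by auto
  define \<zeta> where "\<zeta> = insert x (\<eta> - {Suc x})"
  have "\<zeta> \<in> configs L N"
    unfolding \<zeta>_def by (rule move_in_configs) (use \<eta> x xL in auto)
  moreover have "(Suc x, -1) \<in> moves L \<eta> \<zeta>"
    using x xL by (auto simp: moves_def neighbour_def \<zeta>_def)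
  moreover have "(x, 1) \<in> moves L \<zeta> \<eta>"
  proof -
    have "neighbour L x 1 = Suc x" using xL by (simp add: neighbour_def nat_add_distrib)
    then show ?thesis using x by (auto simp: moves_def \<zeta>_def)
  qed
  moreover have "\<Sum>\<zeta> < \<Sum>\<eta>"
    using fin x sum.remove[OF fin x(1), of "\<lambda>x. x"] by (simp add: \<zeta>_def)
  ultimately show ?thesis using that by blast
qed

text \<open>Steps to the left, which are reversible, connect every configuration to \<open>{..<N}\<close>.\<close>

lemma configs_connected:
  assumes Z: "Z \<subseteq> configs L N" "Z \<noteq> {}"
    and closed: "\<And>\<eta> \<zeta>. \<eta> \<in> Z \<Longrightarrow> \<zeta> \<in> configs L N \<Longrightarrow> moves L \<eta> \<zeta> \<noteq> {} \<Longrightarrow> \<zeta> \<in> Z"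
  shows "Z = configs L N"
proof -
  have ground: "{..<N} \<in> Z" if "\<eta> \<in> Z" for \<eta>
    using that
  proof (induction "\<Sum>\<eta>" arbitrary: \<eta> rule: less_induct)
    case less
    show ?case
    proof (cases "\<eta> = {..<N}")
      case False
      then obtain \<zeta> where "\<zeta> \<in> configs L N" "moves L \<eta> \<zeta> \<noteq> {}" "\<Sum>\<zeta> < \<Sum>\<eta>"
        using exists_left_move less.prems Z(1) by (metis subsetD)
      then show ?thesis using less closed by blast
    qed (use less in simp)
  qed
  have "\<eta> \<in> Z" if "\<eta> \<in> configs L N" for \<eta>
    using that
  proof (induction "\<Sum>\<eta>" arbitrary: \<eta> rule: less_induct)
    case less
    show ?case
    proof (cases "\<eta> = {..<N}")
      case False
      then obtain \<zeta> where "\<zeta> \<in> configs L N" "moves L \<zeta> \<eta> \<noteq> {}" "\<Sum>\<zeta> < \<Sum>\<eta>"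
        using exists_left_move less.prems by metis
      then show ?thesis using less closed by blast
    qed (use ground Z(2) in auto)
  qed
  then show ?thesis using Z(1) by blast
qed

text \<open>The modulus of \<open>\<psi>\<^sub>c\<close>.\<close>

definition ground_state :: "nat \<Rightarrow> nat \<Rightarrow> nat set \<Rightarrow> real" where
  "ground_state L N \<eta> = 2 ^ (N * (N - 1) div 2) / real L powr (real N / 2) *
     (\<Prod>j<N. \<Prod>i<j. sin ((real (site \<eta> j) - real (site \<eta> i)) * pi / real L))"

lemma psi_on_compact_config:
  assumes "1 \<le> N" "N \<le> L - 1"
  obtains e :: complex where "norm e = 1"
    "\<And>\<eta>. psi_on L N (compact_config L N) \<eta> = e * of_real (ground_state L N \<eta>)"
proof -
  obtain e :: complex where e: "norm e = 1"
    "\<And>y. slater L N (momentum N (compact_config L N)) y =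
      e * (2 ^ (N * (N - 1) div 2) * of_real (sine_product L N y))"
    using slater_compact[OF assms] by blast
  have "psi_on L N (compact_config L N) \<eta> = e * of_real (ground_state L N \<eta>)" for \<eta>
    by (simp add: psi_on_slater e(2) ground_state_def sine_product_def)
  then show ?thesis using that e(1) by blast
qed

lemma ground_state_pos:
  assumes "L > 0" "\<eta> \<in> configs L N"
  shows "ground_state L N \<eta> > 0"
  using sine_product_site_pos[OF assms(2)] assms(1)
  by (simp add: ground_state_def sine_product_def)

lemma ground_state_normalized:
  assumes N: "1 \<le> N" "N \<le> L - 1"
  shows "(\<Sum>\<eta>\<in>configs L N. (ground_state L N \<eta>)\<^sup>2) = 1"
proof -
  let ?c = "compact_config L N"
  obtain e :: complex where e: "norm e = 1"
    "\<And>\<eta>. psi_on L N ?c \<eta> = e * of_real (ground_state L N \<eta>)"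
    using psi_on_compact_config[OF N] by blast
  have "psi_on L N ?c \<eta> * cnj (psi_on L N ?c \<eta>) = of_real ((ground_state L N \<eta>)\<^sup>2)" for \<eta>
    unfolding complex_norm_square[symmetric] by (simp add: e norm_mult)
  moreover have "(\<Sum>\<eta>\<in>configs L N. psi_on L N ?c \<eta> * cnj (psi_on L N ?c \<eta>)) = 1"
    using psi_on_orthonormal[of L ?c N ?c] compact_config_in_configs[OF N] N by simp
  ultimately have "complex_of_real (\<Sum>\<eta>\<in>configs L N. (ground_state L N \<eta>)\<^sup>2) = 1" by simp
  then show ?thesis by (simp only: of_real_eq_1_iff)
qed

lemma ground_state_eigenfunction:
  assumes N: "1 \<le> N" "N \<le> L - 1" and \<eta>: "\<eta> \<in> configs L N"
  shows "(\<Sum>\<zeta>\<in>configs L N. real (card (moves L \<eta> \<zeta>)) * ground_state L N \<zeta>) =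
    rho L N (compact_config L N) * ground_state L N \<eta>" (is "?l = ?r")
proof -
  let ?c = "compact_config L N"
  obtain e :: complex where e: "norm e = 1"
    "\<And>\<eta>. psi_on L N ?c \<eta> = e * of_real (ground_state L N \<eta>)"
    using psi_on_compact_config[OF N] by blast
  have "e \<noteq> 0" using e(1) by auto
  have "e * of_real ?l = (\<Sum>\<zeta>\<in>configs L N. of_nat (card (moves L \<eta> \<zeta>)) * psi_on L N ?c \<zeta>)"
    by (simp add: e(2) sum_distrib_left mult_ac)
  also have "\<dots> = e * of_real ?r"
    unfolding psi_on_eigenfunction[OF N \<eta>] by (simp add: e(2))
  finally have "complex_of_real ?l = of_real ?r" using \<open>e \<noteq> 0\<close> by simp
  then show ?thesis by (simp only: of_real_eq_iff)
qed

text \<open>Every \<open>\<rho>\<^sub>\<xi>\<close> is bounded in modulus by comparing \<open>\<psi>\<^sub>\<xi>\<close> with the positive eigenfunction.\<close>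

lemma spectral_radius_adjacency:
  assumes N: "1 \<le> N" "N \<le> L - 1"
  shows "spectral_radius (adjacency_mat L N) = rho L N (compact_config L N)"
proof -
  let ?c = "compact_config L N"
  have c: "?c \<in> configs L N" by (rule compact_config_in_configs[OF N])
  have le: "\<bar>rho L N \<xi>\<bar> \<le> rho L N ?c" if \<xi>: "\<xi> \<in> configs L N" for \<xi>
  proof -
    obtain \<eta> where \<eta>: "\<eta> \<in> configs L N" "psi_on L N \<xi> \<eta> \<noteq> 0"
      using eigenvector_psi_on[OF N \<xi>] unfolding eigenvector_config_vec_iff by blast
    have "norm (complex_of_real (rho L N \<xi>)) \<le> rho L N ?c"
    proof (rule eigenvalue_norm_le_positive_eigenvalue[where S = "configs L N" and
          v = "ground_state L N" and w = "psi_on L N \<xi>" and z = \<eta> and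
          a = "\<lambda>\<eta> \<zeta>. real (card (moves L \<eta> \<zeta>))"])
      show "(\<Sum>\<zeta>\<in>configs L N. of_real (real (card (moves L \<zeta>' \<zeta>))) * psi_on L N \<xi> \<zeta>) =
          complex_of_real (rho L N \<xi>) * psi_on L N \<xi> \<zeta>'" if "\<zeta>' \<in> configs L N" for \<zeta>'
        using psi_on_eigenfunction[OF N that, of \<xi>] by simp
      show "0 < ground_state L N \<zeta>" if "\<zeta> \<in> configs L N" for \<zeta>
        using N that by (intro ground_state_pos) auto
    qed (simp_all add: finite_configs ground_state_eigenfunction[OF N] \<eta>)
    then show ?thesis by simp
  qed
  have spec: "norm ` spectrum (adjacency_mat L N) = (\<lambda>\<xi>. \<bar>rho L N \<xi>\<bar>) ` configs L N"
    unfolding psi_on_eigenbasis(3)[OF N] Setcompr_eq_image image_image by simp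
  have "\<bar>rho L N ?c\<bar> = rho L N ?c" using le[OF c] by simp
  then have "rho L N ?c \<in> (\<lambda>\<xi>. \<bar>rho L N \<xi>\<bar>) ` configs L N" using c by force
  moreover have "r \<le> rho L N ?c" if "r \<in> (\<lambda>\<xi>. \<bar>rho L N \<xi>\<bar>) ` configs L N" for r
    using that le by blast
  ultimately show ?thesis unfolding spectral_radius_def spec
    by (intro Max_eqI) (simp_all add: finite_configs)
qed

text \<open>Connectedness fixes a positive eigenfunction up to a positive factor, and the normalization
  makes that factor 1.\<close>

lemma perron_eigenfunction_iff:
  assumes N: "1 \<le> N" "N \<le> L - 1"
  shows "perron_eigenfunction L N \<psi> \<longleftrightarrow> (\<forall>\<eta>\<in>configs L N. \<psi> \<eta> = ground_state L N \<eta>)"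
proof -
  let ?\<rho> = "rho L N (compact_config L N)" and ?C = "configs L N" and ?g = "ground_state L N"
  have ne: "?C \<noteq> {}" using compact_config_in_configs[OF N] by blast
  have L: "L > 0" using N by simp
  have re: "(\<Sum>\<zeta>\<in>?C. of_nat (card (moves L \<eta> \<zeta>)) * complex_of_real (\<psi> \<zeta>)) =
        of_real ?\<rho> * of_real (\<psi> \<eta>) \<longleftrightarrow>
      (\<Sum>\<zeta>\<in>?C. real (card (moves L \<eta> \<zeta>)) * \<psi> \<zeta>) = ?\<rho> * \<psi> \<eta>" for \<eta>
  proof -
    have "(\<Sum>\<zeta>\<in>?C. of_nat (card (moves L \<eta> \<zeta>)) * complex_of_real (\<psi> \<zeta>)) =
        of_real (\<Sum>\<zeta>\<in>?C. real (card (moves L \<eta> \<zeta>)) * \<psi> \<zeta>)" by simp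
    then show ?thesis by (simp only: of_real_mult[symmetric] of_real_eq_iff)
  qed
  have nrm: "(\<Sum>\<eta>\<in>?C. complex_of_real (\<psi> \<eta>) * cnj (complex_of_real (\<psi> \<eta>))) = 1 \<longleftrightarrow>
      (\<Sum>\<eta>\<in>?C. (\<psi> \<eta>)\<^sup>2) = 1"
  proof -
    have "(\<Sum>\<eta>\<in>?C. complex_of_real (\<psi> \<eta>) * cnj (complex_of_real (\<psi> \<eta>))) =
        of_real (\<Sum>\<eta>\<in>?C. (\<psi> \<eta>)\<^sup>2)" by (simp add: power2_eq_square)
    then show ?thesis by (simp only: of_real_eq_1_iff)
  qed
  have nonzero: "\<exists>\<eta>\<in>?C. complex_of_real (\<psi> \<eta>) \<noteq> 0" if "\<forall>\<eta>\<in>?C. 0 < \<psi> \<eta>"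
  proof -
    obtain \<eta> where "\<eta> \<in> ?C" using ne by blast
    moreover from this have "0 < \<psi> \<eta>" using that by blast
    ultimately show ?thesis by (intro bexI[of _ \<eta>]) simp_all
  qed
  have perron: "perron_eigenfunction L N \<psi> \<longleftrightarrow> (\<forall>\<eta>\<in>?C. 0 < \<psi> \<eta>) \<and>
      (\<forall>\<eta>\<in>?C. (\<Sum>\<zeta>\<in>?C. real (card (moves L \<eta> \<zeta>)) * \<psi> \<zeta>) = ?\<rho> * \<psi> \<eta>) \<and>
      (\<Sum>\<eta>\<in>?C. (\<psi> \<eta>)\<^sup>2) = 1"
    unfolding perron_eigenfunction_def Let_def spectral_radius_adjacency[OF N]
      eigenvector_config_vec_iff config_vec_inner re nrm
    using nonzero by blast
  show ?thesis
  proof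
    assume p: "perron_eigenfunction L N \<psi>"
    have conn: "Z = ?C" if Z: "Z \<subseteq> ?C" "Z \<noteq> {}"
      and cl: "\<And>x y. x \<in> Z \<Longrightarrow> y \<in> ?C \<Longrightarrow> 0 < real (card (moves L x y)) \<Longrightarrow> y \<in> Z" for Z
    proof (rule configs_connected[OF Z])
      fix \<eta> \<zeta> assume h: "\<eta> \<in> Z" "\<zeta> \<in> ?C" "moves L \<eta> \<zeta> \<noteq> {}"
      have "finite (\<eta> \<times> {1, -1 :: int})"
        using h(1) Z(1) finite_subset[of \<eta> "{..<L}"] by (auto simp: configs_def)
      moreover have "moves L \<eta> \<zeta> \<subseteq> \<eta> \<times> {1, -1}" by (auto simp: moves_def)
      ultimately have "finite (moves L \<eta> \<zeta>)" by (rule finite_subset[rotated])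
      then show "\<zeta> \<in> Z" using cl[of \<eta> \<zeta>] h by (simp add: card_gt_0_iff)
    qed
    have \<psi>: "\<And>\<eta>. \<eta> \<in> ?C \<Longrightarrow> 0 < \<psi> \<eta>"
      "\<And>\<eta>. \<eta> \<in> ?C \<Longrightarrow> (\<Sum>\<zeta>\<in>?C. real (card (moves L \<eta> \<zeta>)) * \<psi> \<zeta>) = ?\<rho> * \<psi> \<eta>"
      using p[unfolded perron] by simp_all
    obtain t where t: "0 < t" "\<And>\<eta>. \<eta> \<in> ?C \<Longrightarrow> \<psi> \<eta> = t * ?g \<eta>"
    proof (rule positive_eigenfunction_unique[where S = ?C and v = ?g and w = \<psi> and r = ?\<rho>
          and a = "\<lambda>\<eta> \<zeta>. real (card (moves L \<eta> \<zeta>))"])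
      show "Z = ?C" if "Z \<subseteq> ?C" "Z \<noteq> {}"
        "\<And>x y. x \<in> Z \<Longrightarrow> y \<in> ?C \<Longrightarrow> 0 < real (card (moves L x y)) \<Longrightarrow> y \<in> Z" for Z
        using that by (rule conn)
    qed (simp_all add: finite_configs ne \<psi> ground_state_pos[OF L] ground_state_eigenfunction[OF N])
    have "1 = (\<Sum>\<eta>\<in>?C. (\<psi> \<eta>)\<^sup>2)" using p perron by simp
    also have "\<dots> = t\<^sup>2 * (\<Sum>\<eta>\<in>?C. (?g \<eta>)\<^sup>2)"
      by (simp add: t(2) power_mult_distrib sum_distrib_left)
    finally have "t\<^sup>2 = 1" by (simp add: ground_state_normalized[OF N])
    then have "t = 1" using t(1) by (simp add: power2_eq_1_iff)
    then show "\<forall>\<eta>\<in>?C. \<psi> \<eta> = ?g \<eta>" using t(2) by simp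
  next
    assume eq: "\<forall>\<eta>\<in>?C. \<psi> \<eta> = ?g \<eta>"
    then show "perron_eigenfunction L N \<psi>"
      unfolding perron
      using ground_state_pos[OF L] ground_state_eigenfunction[OF N] ground_state_normalized[OF N]
      by simp
  qed
qed

theorem proposition2p2:
  fixes L N :: nat
  assumes "1 \<le> N" and "N \<le> L - 1"
  shows
    "(\<exists>\<psi>. perron_eigenfunction L N \<psi>) \<and>
     (\<forall>\<psi>. perron_eigenfunction L N \<psi> \<longrightarrow>
        (\<exists>u::complex. norm u = 1 \<and>
           (\<forall>\<eta>\<in>configs L N. complex_of_real (\<psi> \<eta>) = u * psi_on L N (compact_config L N) \<eta>)) \<and>
        (\<forall>\<eta>\<in>configs L N.
           \<psi> \<eta> = 2 ^ (N * (N - 1) div 2) / real L powr (real N / 2) *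
             (\<Prod>j<N. \<Prod>i<j. sin ((real (site \<eta> j) - real (site \<eta> i)) * pi / real L)))) \<and>
     spectral_radius (adjacency_mat L N) = rho L N (compact_config L N) \<and>
     spectral_radius (adjacency_mat L N) = 2 * sin (real N * pi / real L) / sin (pi / real L) \<and>
     (\<exists>B. bij_betw (\<lambda>\<xi>. config_vec L N (psi_on L N \<xi>)) (configs L N) B \<and>
          orthonormal_basis (length (config_list L N)) B) \<and>
     (\<forall>\<xi>\<in>configs L N.
        eigenvector (adjacency_mat L N) (config_vec L N (psi_on L N \<xi>)) (complex_of_real (rho L N \<xi>))) \<and>
     spectrum (adjacency_mat L N) = {complex_of_real (rho L N \<xi>) | \<xi>. \<xi> \<in> configs L N}"
proof (intro conjI allI impI ballI)
  note N = assms
  show "\<exists>\<psi>. perron_eigenfunction L N \<psi>"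
    using perron_eigenfunction_iff[OF N] by blast
  show "\<psi> \<eta> = 2 ^ (N * (N - 1) div 2) / real L powr (real N / 2) *
      (\<Prod>j<N. \<Prod>i<j. sin ((real (site \<eta> j) - real (site \<eta> i)) * pi / real L))"
    if "perron_eigenfunction L N \<psi>" "\<eta> \<in> configs L N" for \<psi> \<eta>
    using that perron_eigenfunction_iff[OF N] by (simp add: ground_state_def)
  show "\<exists>u::complex. norm u = 1 \<and>
      (\<forall>\<eta>\<in>configs L N. complex_of_real (\<psi> \<eta>) = u * psi_on L N (compact_config L N) \<eta>)"
    if "perron_eigenfunction L N \<psi>" for \<psi>
  proof -
    obtain e :: complex where e: "norm e = 1"
      "\<And>\<eta>. psi_on L N (compact_config L N) \<eta> = e * of_real (ground_state L N \<eta>)"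
      using psi_on_compact_config[OF N] by blast
    then have "e \<noteq> 0" by auto
    then have "norm (inverse e) = 1 \<and> (\<forall>\<eta>\<in>configs L N.
        complex_of_real (\<psi> \<eta>) = inverse e * psi_on L N (compact_config L N) \<eta>)"
      using that e by (simp add: perron_eigenfunction_iff[OF N] norm_inverse)
    then show ?thesis by blast
  qed
  show "spectral_radius (adjacency_mat L N) = rho L N (compact_config L N)"
    by (rule spectral_radius_adjacency[OF N])
  then show "spectral_radius (adjacency_mat L N) = 2 * sin (real N * pi / real L) / sin (pi / real L)"
    by (simp only: rho_compact_config[OF N])
  show "\<exists>B. bij_betw (\<lambda>\<xi>. config_vec L N (psi_on L N \<xi>)) (configs L N) B \<and>
      orthonormal_basis (length (config_list L N)) B"
    using psi_on_eigenbasis(1,2)[OF N] by blast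
  show "eigenvector (adjacency_mat L N) (config_vec L N (psi_on L N \<xi>)) (complex_of_real (rho L N \<xi>))"
    if "\<xi> \<in> configs L N" for \<xi>
    by (rule eigenvector_psi_on[OF N that])
  show "spectrum (adjacency_mat L N) = {complex_of_real (rho L N \<xi>) | \<xi>. \<xi> \<in> configs L N}"
    by (rule psi_on_eigenbasis(3)[OF N])
qed

end
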